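(* Let $n\ge3$, let $\Omega\subset\mathbb{R}^n$ be a domain, and let $f\in C^{1,1}$ be a $K$-quasiconformal mapping defined in $\Omega$ with $K<2^{n-1}$. If $G\subsetneq\mathbb{R}^n$ is a domain with $\overline{G}\subset\Omega$ and $G'=f(G)$, then $f$ is bi-Lipschitz with respect to the Euclidean metrics on $G$ and $G'$, and bi-Lipschitz with respect to the quasihyperbolic metrics on $G$ and $G'$.
   Context: A map $f:(M,d_M)\to(N,d_N)$ between metric spaces is bi-Lipschitz if there is a constant $a\ge1$ with $a^{-1}d_M(x,y)\le d_N(f(x),f(y))\le a\,d_M(x,y)$ for all $x,y\in M$. The quasihyperbolic metric of a proper subdomain $D\subsetneq\mathbb{R}^n$ is $k_D(x,y)=\inf_\gamma\int_\gamma \frac{ds}{d(z,\partial D)}$, the infimum being taken over all locally rectifiable curves $\gamma$ in $D$ joining $x$ and $y$, where $d(z,\partial D)$ is the Euclidean distance from $z$ to $\partial D$. $\overline G$ is the closure of $G$. $C^{1,1}$ means continuously differentiable with locally Lipschitz derivative. $f$ is $K$-quasiconformal in $\Omega$ ($K\ge1$) if it is a homeomorphism of $\Omega$ onto a domain in $\mathbb{R}^n$ that is ACL$^n$ (continuous, absolutely continuous on almost every line segment parallel to the coordinate axes in each closed $n$-interval in $\Omega$, with partial derivatives locally in $L^n$) and a.e. satisfies $|f'(x)|^n\le KJ_f(x)$ and $J_f(x)\le K\,l(f'(x))^n$, where $|f'(x)|=\max_{|v|=1}|f'(x)v|$, $l(f'(x))=\min_{|v|=1}|f'(x)v|$, and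 $J_f$ is the Jacobian determinant.
   Formalization: The closure of G is additionally assumed compact, i.e. G is bounded; for unbounded G the claim fails, e.g. f(x)=(1+|x|^2)^((a-1)/2) x with 1<a<2 on Ω=R^n and G a half-space is not Lipschitz although K=a^(n-1)<2^(n-1). *)

theory Defs
  imports "HOL-Analysis.Analysis"
begin

definition is_domain :: "'a::topological_space set \<Rightarrow> bool" where
  "is_domain D \<longleftrightarrow> open D \<and> connected D \<and> D \<noteq> {}"


section \<open>Bi-Lipschitz maps\<close>

text \<open>The metrics are explicit arguments, because the same map is considered both for the
  Euclidean and for the quasihyperbolic metrics.\<close>

definition bi_lipschitz ::
  "'a set \<Rightarrow> ('a \<Rightarrow> 'a \<Rightarrow> real) \<Rightarrow> 'b set \<Rightarrow> ('b \<Rightarrow> 'b \<Rightarrow> real) \<Rightarrow> ('a \<Rightarrow> 'b) \<Rightarrow> bool" where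
  "bi_lipschitz M dM N dN f \<longleftrightarrow>
     f \<in> M \<rightarrow> N \<and>
     (\<exists>a\<ge>1. \<forall>x\<in>M. \<forall>y\<in>M. dM x y / a \<le> dN (f x) (f y) \<and> dN (f x) (f y) \<le> a * dM x y)"


section \<open>Arc length and the quasihyperbolic metric\<close>

text \<open>The polygonal sums of \<open>\<gamma>\<close> over \<open>[a, b]\<close>; a partition is given by a nondecreasing
  sequence of which only the first \<open>m + 1\<close> terms matter.\<close>

definition polygonal_sums :: "(real \<Rightarrow> 'a::metric_space) \<Rightarrow> real \<Rightarrow> real \<Rightarrow> real set" where
  "polygonal_sums \<gamma> a b =
     {(\<Sum>i<m. dist (\<gamma> (t i)) (\<gamma> (t (Suc i)))) | m t.
        (\<forall>i<m. t i \<le> t (Suc i)) \<and> t 0 = a \<and> t m = b}"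

definition rectifiable_path :: "(real \<Rightarrow> 'a::metric_space) \<Rightarrow> bool" where
  "rectifiable_path \<gamma> \<longleftrightarrow> path \<gamma> \<and> bdd_above (polygonal_sums \<gamma> 0 1)"

definition arc_length :: "(real \<Rightarrow> 'a::metric_space) \<Rightarrow> real \<Rightarrow> real \<Rightarrow> real" where
  "arc_length \<gamma> a b = Sup (polygonal_sums \<gamma> a b)"

text \<open>The parametrization by arc length. The value does not depend on the chosen \<open>t\<close>, since a
  rectifiable path is constant on each interval on which its length function is constant.\<close>

definition arc_length_param :: "(real \<Rightarrow> 'a::metric_space) \<Rightarrow> real \<Rightarrow> 'a" where
  "arc_length_param \<gamma> s = \<gamma> (SOME t. t \<in> {0..1} \<and> arc_length \<gamma> 0 t = s)"

text \<open>The line integral of \<open>\<rho>\<close> along a rectifiable path with respect to arc length \<open>ds\<close>.\<close>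

definition line_integral :: "('a::metric_space \<Rightarrow> real) \<Rightarrow> (real \<Rightarrow> 'a) \<Rightarrow> real" where
  "line_integral \<rho> \<gamma> = integral {0..arc_length \<gamma> 0 1} (\<lambda>s. \<rho> (arc_length_param \<gamma> s))"

text \<open>A curve joining two points of \<open>D\<close> is a path on \<open>[0, 1]\<close>; on a compact parameter interval
  local rectifiability is the same as rectifiability.\<close>

definition quasihyperbolic_dist :: "'a::metric_space set \<Rightarrow> 'a \<Rightarrow> 'a \<Rightarrow> real" where
  "quasihyperbolic_dist D x y =
     Inf {line_integral (\<lambda>z. 1 / infdist z (frontier D)) \<gamma> | \<gamma>.
            rectifiable_path \<gamma> \<and> path_image \<gamma> \<subseteq> D \<and> pathstart \<gamma> = x \<and> pathfinish \<gamma> = y}"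


section \<open>Maps of class \<open>C\<^sup>1\<^sup>,\<^sup>1\<close>\<close>

definition C11_on ::
  "'a set \<Rightarrow> ('a::real_normed_vector \<Rightarrow> 'b::real_normed_vector) \<Rightarrow> bool" where
  "C11_on U f \<longleftrightarrow>
     (\<exists>f' :: 'a \<Rightarrow> 'a \<Rightarrow>\<^sub>L 'b.
        (\<forall>x\<in>U. (f has_derivative blinfun_apply (f' x)) (at x)) \<and>
        continuous_on U f' \<and>
        (\<forall>x\<in>U. \<exists>r>0. \<exists>L. L-lipschitz_on (ball x r \<inter> U) f'))"


section \<open>Quasiconformal maps\<close>

definition absolutely_continuous_fun ::
  "real \<Rightarrow> real \<Rightarrow> (real \<Rightarrow> 'a::metric_space) \<Rightarrow> bool" where
  "absolutely_continuous_fun a b g \<longleftrightarrow>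
     (\<forall>\<epsilon>>0. \<exists>\<delta>>0. \<forall>\<I>. \<I> division_of \<Union>\<I> \<and> \<Union>\<I> \<subseteq> {a..b} \<and> (\<Sum>I\<in>\<I>. Sup I - Inf I) < \<delta> \<longrightarrow>
        (\<Sum>I\<in>\<I>. dist (g (Inf I)) (g (Sup I))) < \<epsilon>)"

text \<open>The segments of \<open>cbox a b\<close> parallel to the \<open>i\<close>-th axis are indexed by the points \<open>y\<close> of the
  face spanned by the other axes; ``almost every'' refers to the \<open>(n-1)\<close>-dimensional Lebesgue
  measure on the coordinates \<open>j \<noteq> i\<close>.\<close>

definition ACL_on ::
  "(real^'n) set \<Rightarrow> (real^'n \<Rightarrow> 'b::metric_space) \<Rightarrow> bool" where
  "ACL_on U f \<longleftrightarrow>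
     continuous_on U f \<and>
     (\<forall>a b i. cbox a b \<subseteq> U \<longrightarrow>
        (AE y in (\<Pi>\<^sub>M j\<in>-{i}. (lborel :: real measure)).
           (\<forall>j\<in>-{i}. y j \<in> {a$j..b$j}) \<longrightarrow>
           absolutely_continuous_fun (a$i) (b$i) (\<lambda>t. f (\<chi> j. if j = i then t else y j))))"

definition partial_deriv ::
  "'n \<Rightarrow> (real^'n \<Rightarrow> 'b::real_normed_vector) \<Rightarrow> real^'n \<Rightarrow> 'b" where
  "partial_deriv i f x = vector_derivative (\<lambda>t. f (x + t *\<^sub>R axis i 1)) (at 0)"

definition ACLn_on ::
  "(real^'n) set \<Rightarrow> (real^'n \<Rightarrow> 'b::euclidean_space) \<Rightarrow> bool" where
  "ACLn_on U f \<longleftrightarrow>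
     ACL_on U f \<and>
     (\<forall>i C. compact C \<and> C \<subseteq> U \<longrightarrow>
        set_borel_measurable lebesgue C (partial_deriv i f) \<and>
        set_integrable lebesgue C (\<lambda>x. norm (partial_deriv i f x) ^ CARD('n)))"

definition min_stretch :: "('a::real_normed_vector \<Rightarrow> 'b::real_normed_vector) \<Rightarrow> real" where
  "min_stretch A = (INF v\<in>sphere 0 1. norm (A v))"

text \<open>A homeomorphism of class \<open>ACL\<^sup>n\<close> is differentiable almost everywhere, so requiring the
  (total) derivative \<open>f'(x)\<close> to exist almost everywhere is no additional restriction.\<close>

definition quasiconformal_on ::
  "real \<Rightarrow> (real^'n) set \<Rightarrow> (real^'n \<Rightarrow> real^'n) \<Rightarrow> bool" where
  "quasiconformal_on K U f \<longleftrightarrow>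
     K \<ge> 1 \<and>
     is_domain (f ` U) \<and> (\<exists>g. homeomorphism U (f ` U) f g) \<and>
     ACLn_on U f \<and>
     (AE x in lebesgue. x \<in> U \<longrightarrow>
        (\<exists>f'. (f has_derivative f') (at x) \<and>
              onorm f' ^ CARD('n) \<le> K * det (matrix f') \<and>
              det (matrix f') \<le> K * min_stretch f' ^ CARD('n)))"

end

theory Submission
  imports Defs
begin

text \<open>If the Jacobian vanished at a point of \<open>\<Omega>\<close>, say at \<open>0 = f 0\<close>, then so would the derivative,
  and the Lipschitz condition on \<open>f'\<close> would give \<open>\<bar>f x\<bar> \<le> C \<bar>x\<bar>\<^sup>2\<close>. This contradicts
  \<open>K < 2\<^sup>n\<^sup>-\<^sup>1\<close> by a length-area argument: the annulus between the spheres of radii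
  \<open>C r\<^sup>2\<close> and \<open>min {\<bar>f x\<bar> : \<bar>x\<bar> = R}\<close> has preimage inside \<open>r < \<bar>x\<bar> < R\<close>, the \<open>n\<close>-energy of
  \<open>ln \<bar>f\<bar>\<close> on that preimage is at most \<open>K\<close> times the logarithmic volume of the annulus by change of
  variables, and it is bounded below along each ray. Letting \<open>r\<close> tend to \<open>0\<close> yields
  \<open>2\<^sup>n\<^sup>-\<^sup>1 \<le> K\<close>. Hence \<open>f\<close> is an injective local diffeomorphism near the compact set \<open>closure G\<close> and
  therefore bi-Lipschitz on it. Since \<open>f\<close> maps \<open>frontier G\<close> onto \<open>frontier G'\<close>, distances to the
  boundary and arc lengths are both distorted by at most a constant factor \<open>c\<close>, and the
  quasihyperbolic distances by at most \<open>c\<^sup>2\<close>.\<close>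


text \<open>The threshold 2^(n-1) comes from the radial stretching |x|^(m-1) x: it vanishes to order
  m at 0 and satisfies |f'|^n = m^(n-1) J elsewhere. A Lipschitz derivative forces m = 2 at a
  critical point, and |x| x shows that the bound cannot be improved.

  Since f is C^1, the length-area argument can use every ray. Hoelder's inequality is replaced by
  the pointwise tangent inequality s^n \<ge> n m^(n-1) s - (n-1) m^n, whose slope m is taken to be
  the order of vanishing. Polar coordinates are replaced by an average over rays issuing from a
  shell of logarithmic thickness 1, whose mass cancels in the end.

  On the quasihyperbolic side the obstacle is the parametrization by arc length, which rests on a
  choice of times. The passage from one arc length parameter to the other is monotone and Lipschitz,
  with no derivative at hand, so a bisection argument stands in for the substitution rule.\<close>

section \<open>Change of variables for an arbitrary finite index type\<close>

text \<open>The change of variables theorem of the library assumes a well-ordered index type. A copy of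
  the index type, ordered by an enumeration, satisfies this assumption.\<close>

typedef 'a enumerated = "UNIV :: 'a set" by auto

lemma bij_Rep_enumerated: "bij (Rep_enumerated :: 'a enumerated \<Rightarrow> 'a)"
  by (meson Rep_enumerated_inject bij_def injI surj_def Rep_enumerated_cases UNIV_I)

instance enumerated :: (finite) finite
  by standard (metis finite bij_Rep_enumerated bij_is_inj finite_imageD finite_subset subset_UNIV)

instantiation enumerated :: (finite) wellorder
begin

definition less_eq_enumerated :: "'a enumerated \<Rightarrow> 'a enumerated \<Rightarrow> bool" where
  "less_eq_enumerated x y \<longleftrightarrow> to_nat (Rep_enumerated x) \<le> to_nat (Rep_enumerated y)"

definition less_enumerated :: "'a enumerated \<Rightarrow> 'a enumerated \<Rightarrow> bool" where
  "less_enumerated x y \<longleftrightarrow> to_nat (Rep_enumerated x) < to_nat (Rep_enumerated y)"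

instance
proof
  fix P :: "'a enumerated \<Rightarrow> bool" and a
  assume step: "\<And>x. (\<And>y. y < x \<Longrightarrow> P y) \<Longrightarrow> P x"
  show "P a"
    by (induction a rule: measure_induct_rule[where f="\<lambda>x. to_nat (Rep_enumerated x)"])
       (use step in \<open>auto simp: less_enumerated_def\<close>)
qed (auto simp: less_eq_enumerated_def less_enumerated_def Rep_enumerated_inject)

end

section \<open>Relabelling of coordinates: signs, determinants and Lebesgue measure\<close>

text \<open>Conjugation by \<open>\<pi>\<close> turns the transposition of \<open>a\<close> and
  \<open>b\<close> into that of \<open>inv \<pi> a\<close> and \<open>inv \<pi> b\<close>, so a
  product of \<open>n\<close> transpositions stays one. Here \<open>\<pi>\<close> may join two
  different types, as it does for relabelled coordinates.\<close>

lemma swapidseq_conjugate: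
  assumes "swapidseq n p" and "bij \<pi>"
  shows "swapidseq n (inv \<pi> \<circ> p \<circ> \<pi>)"
  using assms(1)
proof induction
  case id
  have "inv \<pi> \<circ> id \<circ> \<pi> = id"
    using assms(2) by (simp add: fun_eq_iff bij_is_inj)
  then show ?case
    by (simp only: swapidseq.id)
next
  case (comp_Suc n p a b)
  have "inv \<pi> \<circ> (Transposition.transpose a b \<circ> p) \<circ> \<pi> = Transposition.transpose (inv \<pi> a) (inv \<pi> b) \<circ> (inv \<pi> \<circ> p \<circ> \<pi>)"
    using assms(2) bij_is_inj[OF bij_imp_bij_inv[OF assms(2)]]
    by (auto simp: fun_eq_iff Transposition.transpose_def inj_eq)
  moreover have "inv \<pi> a \<noteq> inv \<pi> b"
    using comp_Suc.hyps bij_is_inj[OF bij_imp_bij_inv[OF assms(2)]] by (auto simp: inj_eq)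
  ultimately show ?case
    using swapidseq.comp_Suc[OF comp_Suc.IH] by metis
qed

lemma sign_conjugate:
  assumes "permutation p" and "bij \<pi>"
  shows "sign (inv \<pi> \<circ> p \<circ> \<pi>) = sign p"
proof -
  obtain n where "swapidseq n p"
    using assms(1) by (auto simp: permutation_def)
  then have "evenperm (inv \<pi> \<circ> p \<circ> \<pi>) = evenperm p"
    using swapidseq_conjugate[OF _ assms(2)] evenperm_unique by metis
  then show ?thesis
    by (simp add: sign_def)
qed

text \<open>In the Leibniz sum, conjugation by \<open>\<pi>\<close> matches the permutations of the
  two index sets; it keeps signs, and reindexing by \<open>\<pi>\<close> identifies the
  products.\<close>

lemma det_reindex:
  fixes A :: "'a::comm_ring_1^'n^'n" and \<pi> :: "'m::finite \<Rightarrow> 'n"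
  assumes "bij \<pi>"
  shows "det (\<chi> i j. A $ \<pi> i $ \<pi> j) = det A"
proof -
  have inj: "inj \<pi>" and surj: "surj \<pi>"
    using assms by (auto simp: bij_def)
  have "det A = (\<Sum>p | p permutes (UNIV :: 'n set). of_int (sign p) * (\<Prod>i\<in>UNIV. A $ i $ p i))"
    by (simp add: det_def)
  also have "\<dots> = (\<Sum>p | p permutes (UNIV :: 'm set). of_int (sign p) * (\<Prod>i\<in>UNIV. A $ \<pi> i $ \<pi> (p i)))"
  proof (rule sum.reindex_bij_witness[where i="\<lambda>p. \<pi> \<circ> p \<circ> inv \<pi>" and j="\<lambda>p. inv \<pi> \<circ> p \<circ> \<pi>"])
    fix p :: "'n \<Rightarrow> 'n" assume "p \<in> {p. p permutes UNIV}"
    then have p: "p permutes UNIV" by simp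
    then have "permutation p"
      by (meson finite permutation_permutes)
    show "\<pi> \<circ> (inv \<pi> \<circ> p \<circ> \<pi>) \<circ> inv \<pi> = p"
      using surj by (simp add: fun_eq_iff surj_f_inv_f)
    show "inv \<pi> \<circ> p \<circ> \<pi> \<in> {p. p permutes UNIV}"
      using assms p by (auto intro!: bij_imp_permutes bij_comp bij_imp_bij_inv simp: permutes_bij)
    have "(\<Prod>i\<in>UNIV. A $ i $ p i) = (\<Prod>i\<in>UNIV. A $ \<pi> i $ p (\<pi> i))"
      by (rule prod.reindex_bij_betw[OF assms, symmetric])
    then show "of_int (sign (inv \<pi> \<circ> p \<circ> \<pi>)) * (\<Prod>i\<in>UNIV. A $ \<pi> i $ \<pi> ((inv \<pi> \<circ> p \<circ> \<pi>) i)) =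
        of_int (sign p) * (\<Prod>i\<in>UNIV. A $ i $ p i)"
      using sign_conjugate[OF \<open>permutation p\<close> assms] surj
      by (simp add: surj_f_inv_f)
  next
    fix p :: "'m \<Rightarrow> 'm" assume "p \<in> {p. p permutes UNIV}"
    then have p: "p permutes UNIV" by simp
    show "inv \<pi> \<circ> (\<pi> \<circ> p \<circ> inv \<pi>) \<circ> \<pi> = p"
      using inj by (simp add: fun_eq_iff)
    show "\<pi> \<circ> p \<circ> inv \<pi> \<in> {p. p permutes UNIV}"
      using assms p by (auto intro!: bij_imp_permutes bij_comp bij_imp_bij_inv simp: permutes_bij)
  qed
  finally show ?thesis
    by (simp add: det_def)
qed

text \<open>It suffices to compare boxes: the preimage of a box is a box with the same side lengths
  in another order.\<close>

lemma lborel_reindex: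
  fixes \<pi> :: "'m::finite \<Rightarrow> 'n::finite"
  assumes "bij \<pi>"
  shows "distr lborel borel (\<lambda>x::real^'n. \<chi> i. x $ \<pi> i) = (lborel :: (real^'m) measure)"
proof (rule lborel_eqI[symmetric])
  fix l u :: "real^'m"
  assume le: "\<And>b. b \<in> Basis \<Longrightarrow> l \<bullet> b \<le> u \<bullet> b"
  then have le': "l $ i \<le> u $ i" for i
    using le[of "axis i 1"] by (simp add: inner_axis)
  have surj: "surj \<pi>" and inj: "inj \<pi>"
    using assms by (auto simp: bij_def)
  have [measurable]: "(\<lambda>x::real^'n. \<chi> i. x $ \<pi> i) \<in> borel_measurable borel"
    by (intro borel_measurable_continuous_onI continuous_intros)
  have "(\<lambda>x::real^'n. \<chi> i. x $ \<pi> i) -` box l u = box (\<chi> j. l $ inv \<pi> j) (\<chi> j. u $ inv \<pi> j)"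
    using inj surj by (auto simp: mem_box_cart) (metis inv_f_f surj_f_inv_f)+
  then have "emeasure (distr lborel borel (\<lambda>x::real^'n. \<chi> i. x $ \<pi> i)) (box l u) =
      emeasure lborel (box (\<chi> j. l $ inv \<pi> j) (\<chi> j. u $ inv \<pi> j))"
    by (simp add: emeasure_distr)
  also have "\<dots> = (\<Prod>b\<in>Basis. ((\<chi> j. u $ inv \<pi> j) - (\<chi> j. l $ inv \<pi> j) :: real^'n) \<bullet> b)"
    by (rule emeasure_lborel_box) (auto simp: Basis_vec_def inner_axis le')
  also have "\<dots> = (\<Prod>j\<in>UNIV. u $ inv \<pi> j - l $ inv \<pi> j)"
    by (simp add: Basis_vec_def UNION_singleton_eq_range prod.reindex axis_eq_axis inj_on_def inner_axis)
  also have "\<dots> = (\<Prod>i\<in>UNIV. u $ i - l $ i)"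
    using prod.reindex_bij_betw[OF bij_imp_bij_inv[OF assms], of "\<lambda>i. u $ i - l $ i"] by simp
  also have "\<dots> = (\<Prod>b\<in>Basis. (u - l) \<bullet> b)"
    by (simp add: Basis_vec_def UNION_singleton_eq_range prod.reindex axis_eq_axis inj_on_def inner_axis)
  finally show "emeasure (distr lborel borel (\<lambda>x::real^'n. \<chi> i. x $ \<pi> i)) (box l u) = (\<Prod>b\<in>Basis. (u - l) \<bullet> b)" .
qed simp

section \<open>Change of variables for nonnegative integrands\<close>

text \<open>The finite value \<open>ennreal b\<close> makes \<open>\<phi>\<close> absolutely
  integrable on the image. Nonnegativity then lets the vector-valued formula, applied with values in
  \<open>real^1\<close>, be read back as a statement about nonnegative integrals.\<close>

lemma nn_integral_change_of_variables_wellorder: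
  fixes g :: "real^'m::{finite,wellorder} \<Rightarrow> real^'m::_" and \<phi> :: "real^'m::_ \<Rightarrow> real"
  assumes S: "S \<in> sets borel" and gS: "g ` S \<in> sets borel"
    and der: "\<And>x. x \<in> S \<Longrightarrow> (g has_derivative g' x) (at x within S)"
    and inj: "inj_on g S"
    and \<phi>: "\<phi> \<in> borel_measurable borel" "\<And>y. 0 \<le> \<phi> y"
    and int: "(\<integral>\<^sup>+y. ennreal (indicator (g ` S) y * \<phi> y) \<partial>lborel) = ennreal b" and "0 \<le> b"
  shows "(\<integral>\<^sup>+x. ennreal (indicator S x * (\<bar>det (matrix (g' x))\<bar> * \<phi> (g x))) \<partial>lborel) = ennreal b"
proof -
  have "((\<lambda>y. indicator (g ` S) y * \<phi> y) has_integral b) UNIV"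
    by (rule nn_integral_has_integral) (use \<phi> gS int \<open>0 \<le> b\<close> in auto)
  moreover have "(\<lambda>y. indicator (g ` S) y * \<phi> y) = (\<lambda>y. if y \<in> g ` S then \<phi> y else 0)"
    by (auto simp: indicator_def)
  ultimately have "(\<phi> has_integral b) (g ` S)"
    by (simp add: has_integral_restrict_UNIV)
  then have "(\<lambda>y. vec (\<phi> y) :: real^1) absolutely_integrable_on (g ` S) \<and>
      integral (g ` S) (\<lambda>y. vec (\<phi> y) :: real^1) = vec b"
    using \<phi> by (auto simp: absolutely_integrable_on_1_iff integral_on_1_eq absolutely_integrable_on_iff_nonneg has_integral_iff)
  then have "(\<lambda>x. \<bar>det (matrix (g' x))\<bar> *\<^sub>R vec (\<phi> (g x)) :: real^1) absolutely_integrable_on S \<and>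
      integral S (\<lambda>x. \<bar>det (matrix (g' x))\<bar> *\<^sub>R vec (\<phi> (g x)) :: real^1) = vec b"
    using has_absolute_integral_change_of_variables[OF _ der inj, of "\<lambda>y. vec (\<phi> y) :: real^1" "vec b"] S
    by simp
  then have "((\<lambda>x. \<bar>det (matrix (g' x))\<bar> * \<phi> (g x)) has_integral b) S"
    using \<phi> by (auto simp: absolutely_integrable_on_1_iff integral_on_1_eq absolutely_integrable_on_iff_nonneg has_integral_iff)
  then show ?thesis
    by (rule nn_integral_has_integral_lebesgue[rotated]) (use \<phi> in auto)
qed

text \<open>Relabelling is linear and preserves Lebesgue measure, so conjugating \<open>g\<close>
  with it changes neither Jacobian determinants nor integrals. The hypothesis \<open>meas\<close>
  serves the pushforward of the Jacobian side.\<close>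

lemma nn_integral_change_of_variables:
  fixes g :: "real^'n \<Rightarrow> real^'n" and \<phi> :: "real^'n \<Rightarrow> real"
  assumes S: "S \<in> sets borel" and gS: "g ` S \<in> sets borel"
    and der: "\<And>x. x \<in> S \<Longrightarrow> (g has_derivative g' x) (at x within S)"
    and inj: "inj_on g S"
    and \<phi>: "\<phi> \<in> borel_measurable borel" "\<And>y. 0 \<le> \<phi> y"
    and meas: "(\<lambda>x. indicator S x * (\<bar>det (matrix (g' x))\<bar> * \<phi> (g x))) \<in> borel_measurable borel"
    and int: "(\<integral>\<^sup>+y. ennreal (indicator (g ` S) y * \<phi> y) \<partial>lborel) = ennreal b" and "0 \<le> b"
  shows "(\<integral>\<^sup>+x. ennreal (indicator S x * (\<bar>det (matrix (g' x))\<bar> * \<phi> (g x))) \<partial>lborel) = ennreal b"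
proof -
  define \<pi> where "\<pi> = (Rep_enumerated :: 'n enumerated \<Rightarrow> 'n)"
  have \<pi>: "bij \<pi>" "inj \<pi>" "surj \<pi>"
    using bij_Rep_enumerated by (auto simp: \<pi>_def bij_def)
  define P where "P = (\<lambda>x::real^'n. \<chi> i. x $ \<pi> i)"
  define Q where "Q = (\<lambda>z::real^'n enumerated. \<chi> j. z $ inv \<pi> j)"
  have PQ [simp]: "P (Q z) = z" "Q (P x) = x" for x z
    using \<pi> by (auto simp: P_def Q_def vec_eq_iff surj_f_inv_f)
  have lin: "linear P" "linear Q"
    by (auto intro!: linearI simp: P_def Q_def vec_eq_iff)
  have [measurable]: "P \<in> borel_measurable borel" "Q \<in> borel_measurable borel"
    using lin by (auto intro!: borel_measurable_continuous_onI linear_continuous_on simp: linear_conv_bounded_linear)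
  have dP: "distr lborel borel P = lborel"
    using lborel_reindex[OF \<pi>(1)] by (simp add: P_def)
  have dQ: "distr lborel borel Q = lborel"
    using lborel_reindex[OF bij_imp_bij_inv[OF \<pi>(1)]] by (simp add: Q_def)
  define h where "h = P \<circ> g \<circ> Q"
  define h' where "h' = (\<lambda>z. P \<circ> g' (Q z) \<circ> Q)"
  have im: "P ` A = Q -` A" for A
    by (auto simp: image_iff) (metis PQ)
  have borel_P: "P ` A \<in> sets borel" if "A \<in> sets borel" for A
    using measurable_sets[of Q borel borel A] that by (simp add: im)
  have hS: "h ` (P ` S) = P ` (g ` S)"
    by (force simp: h_def image_iff)
  have blin: "bounded_linear P" "bounded_linear Q"
    using lin by (simp_all add: linear_conv_bounded_linear)
  have QS: "Q ` P ` S = S"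
    by (force simp: image_iff)
  have det: "det (matrix (h' z)) = det (matrix (g' (Q z)))" for z
  proof -
    have "matrix (h' z) = (\<chi> i j. matrix (g' (Q z)) $ \<pi> i $ \<pi> j)"
    proof -
      have "Q (axis j 1) = axis (\<pi> j) 1" for j
        using \<pi> by (auto simp: Q_def axis_def vec_eq_iff surj_f_inv_f inv_f_f)
      then have "P (g' (Q z) (Q (axis j 1))) $ i = g' (Q z) (axis (\<pi> j) 1) $ \<pi> i" for i j
        by (subst P_def) (simp only: vec_lambda_beta)
      then show ?thesis
        by (simp add: matrix_def h'_def)
    qed
    then show ?thesis
      by (simp add: det_reindex[OF \<pi>(1)])
  qed
  have "(\<integral>\<^sup>+z. ennreal (indicator (P ` S) z * (\<bar>det (matrix (h' z))\<bar> * (\<phi> \<circ> Q) (h z))) \<partial>lborel) = ennreal b"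
  proof (rule nn_integral_change_of_variables_wellorder)
    show "P ` S \<in> sets borel" "h ` (P ` S) \<in> sets borel"
      using borel_P[OF S] borel_P[OF gS] by (simp_all add: hS)
    show "inj_on h (P ` S)"
      using inj by (auto simp: inj_on_def h_def) (metis PQ(2))
    show "\<phi> \<circ> Q \<in> borel_measurable borel" "0 \<le> (\<phi> \<circ> Q) y" for y
      using \<phi> by auto
    show "(h has_derivative h' z) (at z within P ` S)" if "z \<in> P ` S" for z
    proof -
      have "Q z \<in> S"
        using that by auto
      then have "(g has_derivative g' (Q z)) (at (Q z) within Q ` P ` S)"
        using der by (simp add: QS)
      then have "(g \<circ> Q has_derivative g' (Q z) \<circ> Q) (at z within P ` S)"
        by (intro diff_chain_within bounded_linear_imp_has_derivative blin)
      from diff_chain_within[OF this bounded_linear_imp_has_derivative[OF blin(1)]] show ?thesis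
        by (simp add: h_def h'_def o_assoc)
    qed
    have "(\<integral>\<^sup>+y. ennreal (indicator (h ` P ` S) y * (\<phi> \<circ> Q) y) \<partial>lborel) =
        (\<integral>\<^sup>+y. ennreal (indicator (g ` S) (Q y) * \<phi> (Q y)) \<partial>lborel)"
      unfolding hS im[of "g ` S"] by (intro nn_integral_cong) (auto simp: indicator_def)
    also have "\<dots> = (\<integral>\<^sup>+y. ennreal (indicator (g ` S) y * \<phi> y) \<partial>distr lborel borel Q)"
      by (rule nn_integral_distr[symmetric]) (use \<phi> gS in auto)
    finally show "(\<integral>\<^sup>+y. ennreal (indicator (h ` P ` S) y * (\<phi> \<circ> Q) y) \<partial>lborel) = ennreal b"
      using int by (simp add: dQ)
  qed fact
  also have "(\<integral>\<^sup>+z. ennreal (indicator (P ` S) z * (\<bar>det (matrix (h' z))\<bar> * (\<phi> \<circ> Q) (h z))) \<partial>lborel) =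
      (\<integral>\<^sup>+z. ennreal (indicator S (Q z) * (\<bar>det (matrix (g' (Q z)))\<bar> * \<phi> (g (Q z)))) \<partial>lborel)"
    unfolding im det by (intro nn_integral_cong) (auto simp: indicator_def h_def)
  also have "\<dots> = (\<integral>\<^sup>+x. ennreal (indicator S x * (\<bar>det (matrix (g' x))\<bar> * \<phi> (g x))) \<partial>distr lborel borel Q)"
    by (rule nn_integral_distr[symmetric]) (use meas in auto)
  finally show ?thesis
    by (simp add: dQ)
qed


section \<open>Logarithmic volume of spherical shells\<close>

text \<open>The left-hand side is the tangent at \<open>s = m\<close> of the convex function
  \<open>s ^ n\<close>. Being affine in \<open>s\<close>, it can be integrated along a ray directly,
  and equality at \<open>s = m\<close> keeps the final estimate sharp.\<close>

lemma young_power: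
  fixes m s :: real
  assumes "0 < m" "0 \<le> s"
  shows "n * m ^ (n - 1) * s - (real n - 1) * m ^ n \<le> s ^ n"
proof (cases n)
  case (Suc k)
  have "1 + real n * (s / m - 1) \<le> (1 + (s / m - 1)) ^ n"
    by (rule Bernoulli_inequality) (use assms in auto)
  then have "m ^ n * (1 + real n * (s / m - 1)) \<le> m ^ n * (s / m) ^ n"
    using assms by (intro mult_left_mono) auto
  also have "\<dots> = s ^ n"
    using assms by (simp add: power_divide)
  finally have "m ^ n * (1 + real n * (s / m - 1)) \<le> s ^ n" .
  moreover have "m ^ n * (1 + real n * (s / m - 1)) = n * m ^ (n - 1) * s - (real n - 1) * m ^ n"
    using assms Suc by (simp add: field_simps)
  ultimately show ?thesis by simp
qed (use assms in simp)

section \<open>The dilation-invariant measure |x|^(-n) dx\<close>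

lemma nn_integral_lborel_scaleR:
  fixes f :: "'a::euclidean_space \<Rightarrow> ennreal"
  assumes [measurable]: "f \<in> borel_measurable borel" and "0 < c"
  shows "(\<integral>\<^sup>+x. f x \<partial>lborel) = ennreal (c ^ DIM('a)) * (\<integral>\<^sup>+x. f (c *\<^sub>R x) \<partial>lborel)"
proof -
  have "(\<integral>\<^sup>+x. f x \<partial>lborel) =
      (\<integral>\<^sup>+x. f x \<partial>density (distr lborel borel (\<lambda>x::'a. 0 + c *\<^sub>R x)) (\<lambda>_. \<bar>c\<bar> ^ DIM('a)))"
    using lborel_affine[of c "0::'a"] assms by simp
  also have "\<dots> = (\<integral>\<^sup>+x. ennreal (c ^ DIM('a)) * f (c *\<^sub>R x) \<partial>lborel)"
    using assms by (subst nn_integral_density; simp add: nn_integral_distr)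
  finally show ?thesis
    by (simp add: nn_integral_cmult)
qed

definition shell :: "real \<Rightarrow> 'a::real_normed_vector set" where
  "shell s = {x. s < norm x \<and> norm x \<le> s * exp 1}"

text \<open>By polar coordinates this is the surface area of the unit sphere, but its value never
  matters: it occurs on both sides of the energy inequality and, being finite and positive,
  cancels.\<close>

definition shell_mass :: "'a::euclidean_space itself \<Rightarrow> ennreal" where
  "shell_mass _ = (\<integral>\<^sup>+(x::'a). ennreal (indicator (shell 1) x * (1 / norm x ^ DIM('a))) \<partial>lborel)"

lemma borel_shell [measurable]: "(shell s :: 'a::euclidean_space set) \<in> sets borel"
  unfolding shell_def by measurable

text \<open>The factor \<open>s ^ DIM('a)\<close> produced by a dilation cancels the one in the
  density.\<close>

lemma nn_integral_shell:
  assumes "0 < s"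
  shows "(\<integral>\<^sup>+(x::'a::euclidean_space). ennreal (indicator (shell s) x * (1 / norm x ^ DIM('a))) \<partial>lborel) =
    shell_mass TYPE('a)"
proof -
  have "(\<integral>\<^sup>+(x::'a). ennreal (indicator (shell s) x * (1 / norm x ^ DIM('a))) \<partial>lborel) =
     ennreal (s ^ DIM('a)) *
       (\<integral>\<^sup>+(x::'a). ennreal (indicator (shell s) (s *\<^sub>R x) * (1 / norm (s *\<^sub>R x) ^ DIM('a))) \<partial>lborel)"
    by (rule nn_integral_lborel_scaleR) (use assms in auto)
  also have "\<dots> = (\<integral>\<^sup>+(x::'a). ennreal (s ^ DIM('a)) *
      ennreal (indicator (shell s) (s *\<^sub>R x) * (1 / norm (s *\<^sub>R x) ^ DIM('a))) \<partial>lborel)"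
    by (simp add: nn_integral_cmult)
  also have "\<dots> = shell_mass TYPE('a)"
    unfolding shell_mass_def using assms
    by (intro nn_integral_cong)
       (auto simp: indicator_def shell_def ennreal_mult'[symmetric] field_simps power_mult_distrib)
  finally show ?thesis .
qed

lemma shell_mass_finite: "shell_mass TYPE('a::euclidean_space) < \<infinity>"
proof -
  have "shell_mass TYPE('a) \<le> (\<integral>\<^sup>+x. indicator (cball (0::'a) (exp 1)) x \<partial>lborel)"
    unfolding shell_mass_def
    by (intro nn_integral_mono)
       (auto simp: indicator_def shell_def divide_le_eq_1 less_le_trans[OF zero_less_one] one_le_power)
  also have "\<dots> < \<infinity>"
    using emeasure_lborel_cball_finite[of "0::'a" "exp 1"] by (simp add: less_top)
  finally show ?thesis .
qed

lemma shell_mass_pos: "0 < shell_mass TYPE('a::euclidean_space)"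
proof -
  let ?f = "\<lambda>x::'a. ennreal (indicator (shell 1) x * (1 / norm x ^ DIM('a)))"
  let ?U = "{x::'a. 1 < norm x} \<inter> ball 0 (exp 1)"
  have "open ?U"
    by (intro open_Int open_Collect_less continuous_intros) auto
  obtain b :: 'a where b: "b \<in> Basis"
    using nonempty_Basis by blast
  have e: "1 < (1 + exp 1) / (2::real)" "(1 + exp 1) / 2 < exp (1::real)"
    using exp_gt_one[of "1::real"] by auto
  then have "((1 + exp 1) / 2) *\<^sub>R b \<in> ?U"
    using b by simp
  then have "\<not> negligible ?U"
    using open_not_negligible[OF \<open>open ?U\<close>] by blast
  moreover have "?U \<in> sets borel"
    using \<open>open ?U\<close> by simp
  ultimately have "emeasure lborel ?U \<noteq> 0"
    by (auto simp: negligible_iff_null_sets null_sets_def)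
  moreover have "?U \<subseteq> {x. ?f x \<noteq> 0}"
    by (auto simp: indicator_def shell_def)
  ultimately have "emeasure lborel {x. ?f x \<noteq> 0} \<noteq> 0"
    using emeasure_mono[of ?U "{x. ?f x \<noteq> 0}" lborel] by force
  then have "shell_mass TYPE('a) \<noteq> 0"
    unfolding shell_mass_def by (subst nn_integral_0_iff) auto
  then show ?thesis
    by (simp add: zero_less_iff_neq_zero)
qed

text \<open>The annulus is a disjoint union of \<open>N\<close> shells of equal mass. This count is
  the reason why the thickness of the target annulus is a natural number.\<close>

lemma nn_integral_annulus:
  assumes "0 < M"
  shows "(\<integral>\<^sup>+(y::'a::euclidean_space). ennreal (indicator {y. M < norm y \<and> norm y \<le> M * exp (real N)} y * (1 / norm y ^ DIM('a))) \<partial>lborel) =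
    of_nat N * shell_mass TYPE('a)"
proof (induction N)
  case 0
  have "{y::'a. M < norm y \<and> norm y \<le> M} = {}" by auto
  then show ?case by simp
next
  case (Suc N)
  let ?A = "\<lambda>N. {y::'a. M < norm y \<and> norm y \<le> M * exp (real N)}"
  let ?S = "shell (M * exp (real N)) :: 'a set"
  have "1 \<le> exp (real N)" by simp
  then have le: "M \<le> M * exp (real N)" using assms by simp
  have [measurable]: "?A N \<in> sets borel" for N by measurable
  have "M * exp (real N) * 1 \<le> M * exp (real N) * exp 1"
    using assms by (intro mult_left_mono) auto
  then have "indicator (?A (Suc N)) y = indicator (?A N) y + (indicator ?S y :: real)" for y
    using le by (auto simp: indicator_def shell_def exp_add[of 1] exp_add[of _ 1] mult_ac)
  then have "(\<integral>\<^sup>+y. ennreal (indicator (?A (Suc N)) y * (1 / norm y ^ DIM('a))) \<partial>lborel) =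
     (\<integral>\<^sup>+y. ennreal (indicator (?A N) y * (1 / norm y ^ DIM('a))) + ennreal (indicator ?S y * (1 / norm y ^ DIM('a))) \<partial>lborel)"
    by (simp add: ennreal_plus[symmetric] add_divide_distrib del: ennreal_plus)
  also have "\<dots> = of_nat N * shell_mass TYPE('a) + shell_mass TYPE('a)"
    using Suc.IH nn_integral_shell[where 'a='a, of "M * exp (real N)"] assms by (subst nn_integral_add) auto
  finally show ?case
    by (simp add: distrib_right add.commute)
qed

section \<open>Averaging over rays\<close>

lemma nn_integral_inverse_le_1:
  assumes "0 < a"
  shows "(\<integral>\<^sup>+t. ennreal (indicator {a..a * exp 1} t * (1 / t)) \<partial>lborel) = 1"
proof -
  have "((\<lambda>t. 1 / t) has_integral ln (a * exp 1) - ln a) {a..a * exp 1}"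
    using assms by (intro fundamental_theorem_of_calculus)
      (auto simp: has_real_derivative_iff_has_vector_derivative[symmetric] intro!: derivative_eq_intros)
  from nn_integral_has_integral_lebesgue[OF _ this] show ?thesis
    using assms by (simp add: ln_mult)
qed

text \<open>With y = t x, Fubini turns the left-hand side into the integral of \<open>h y\<close>
  weighted by the integral of dt/t over the t in [1, T] with y/t in the shell. Such t satisfy |y|/(s
  e) \<le> t < |y|/s, an interval of logarithmic length 1, so the weight is at most 1.\<close>

lemma nn_integral_radial_le:
  fixes h :: "'a::euclidean_space \<Rightarrow> ennreal"
  assumes [measurable]: "h \<in> borel_measurable borel" and "0 < s"
  shows "(\<integral>\<^sup>+x. indicator (shell s) x *
      (\<integral>\<^sup>+t. ennreal (indicator {1..T} t * t ^ (DIM('a) - 1)) * h (t *\<^sub>R x) \<partial>lborel) \<partial>lborel) \<le> (\<integral>\<^sup>+x. h x \<partial>lborel)"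
proof -
  have "(\<integral>\<^sup>+x. indicator (shell s) x *
      (\<integral>\<^sup>+t. ennreal (indicator {1..T} t * t ^ (DIM('a) - 1)) * h (t *\<^sub>R x) \<partial>lborel) \<partial>lborel) =
     (\<integral>\<^sup>+x. (\<integral>\<^sup>+t. indicator (shell s) x *
      (ennreal (indicator {1..T} t * t ^ (DIM('a) - 1)) * h (t *\<^sub>R x)) \<partial>lborel) \<partial>lborel)"
    by (simp add: nn_integral_cmult)
  also have "\<dots> = (\<integral>\<^sup>+t. (\<integral>\<^sup>+x. indicator (shell s) x *
      (ennreal (indicator {1..T} t * t ^ (DIM('a) - 1)) * h (t *\<^sub>R x)) \<partial>lborel) \<partial>lborel)"
    by (rule lborel_pair.Fubini') measurable
  also have "\<dots> = (\<integral>\<^sup>+t. (\<integral>\<^sup>+y. ennreal (indicator {1..T} t * (1 / t)) *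
      (indicator (shell s) ((1 / t) *\<^sub>R y) * h y) \<partial>lborel) \<partial>lborel)"
  proof (rule nn_integral_cong)
    fix t :: real
    show "(\<integral>\<^sup>+x. indicator (shell s) x *
        (ennreal (indicator {1..T} t * t ^ (DIM('a) - 1)) * h (t *\<^sub>R x)) \<partial>lborel) =
      (\<integral>\<^sup>+y. ennreal (indicator {1..T} t * (1 / t)) *
        (indicator (shell s) ((1 / t) *\<^sub>R y) * h y) \<partial>lborel)"
    proof (cases "t \<in> {1..T}")
      case True
      then have t: "0 < t" by auto
      have D: "t ^ DIM('a) = t * t ^ (DIM('a) - 1)"
        by (simp add: power_eq_if)
      have "(\<integral>\<^sup>+y. ennreal (indicator {1..T} t * (1 / t)) *
          (indicator (shell s) ((1 / t) *\<^sub>R y) * h y) \<partial>lborel) =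
        ennreal (t ^ DIM('a)) * (\<integral>\<^sup>+y. ennreal (indicator {1..T} t * (1 / t)) *
          (indicator (shell s) ((1 / t) *\<^sub>R (t *\<^sub>R y)) * h (t *\<^sub>R y)) \<partial>lborel)"
        by (rule nn_integral_lborel_scaleR) (use t in auto)
      also have "\<dots> = (\<integral>\<^sup>+y. ennreal (t ^ DIM('a)) * (ennreal (indicator {1..T} t * (1 / t)) *
          (indicator (shell s) ((1 / t) *\<^sub>R (t *\<^sub>R y)) * h (t *\<^sub>R y))) \<partial>lborel)"
        by (simp add: nn_integral_cmult)
      also have "\<dots> = (\<integral>\<^sup>+x. indicator (shell s) x *
          (ennreal (indicator {1..T} t * t ^ (DIM('a) - 1)) * h (t *\<^sub>R x)) \<partial>lborel)"
        using t True unfolding D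
        by (intro nn_integral_cong) (auto simp: mult.assoc[symmetric] ennreal_mult'[symmetric] indicator_def)
      finally show ?thesis by simp
    qed auto
  qed
  also have "\<dots> = (\<integral>\<^sup>+y. (\<integral>\<^sup>+t. ennreal (indicator {1..T} t * (1 / t)) *
      (indicator (shell s) ((1 / t) *\<^sub>R y) * h y) \<partial>lborel) \<partial>lborel)"
    by (rule lborel_pair.Fubini') measurable
  also have "\<dots> \<le> (\<integral>\<^sup>+y. h y \<partial>lborel)"
  proof (rule nn_integral_mono)
    fix y :: 'a
    let ?a = "norm y / (s * exp 1)"
    show "(\<integral>\<^sup>+t. ennreal (indicator {1..T} t * (1 / t)) * (indicator (shell s) ((1 / t) *\<^sub>R y) * h y) \<partial>lborel) \<le> h y"
    proof (cases "y = 0")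
      case True
      then show ?thesis using assms(2) by (simp add: shell_def)
    next
      case False
      have "(\<integral>\<^sup>+t. ennreal (indicator {1..T} t * (1 / t)) * (indicator (shell s) ((1 / t) *\<^sub>R y) * h y) \<partial>lborel) \<le>
        (\<integral>\<^sup>+t. ennreal (indicator {?a..?a * exp 1} t * (1 / t)) * h y \<partial>lborel)"
        using assms(2) by (intro nn_integral_mono) (auto simp: indicator_def shell_def field_simps)
      also have "\<dots> = (\<integral>\<^sup>+t. ennreal (indicator {?a..?a * exp 1} t * (1 / t)) \<partial>lborel) * h y"
        by (rule nn_integral_multc) measurable
      also have "\<dots> = h y"
        using nn_integral_inverse_le_1[of ?a] False assms(2) by simp
      finally show ?thesis .
    qed
  qed
  finally show ?thesis .
qed


section \<open>Order of vanishing of a quasiconformal map\<close>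

text \<open>\<open>u\<close> is the last time with \<open>g \<le> a\<close>, and \<open>v\<close>
  the first time from \<open>u\<close> on with \<open>b \<le> g\<close>. Strictly between them both
  levels are avoided, so this piece of the ray lies where the energy is counted.\<close>

lemma ray_crossing:
  fixes g :: "real \<Rightarrow> real"
  assumes g: "continuous_on {p..q} g" and "p \<le> q" and "g p \<le> a" "b \<le> g q" "a < b"
  obtains u v where "p \<le> u" "u \<le> v" "v \<le> q" "g u \<le> a" "b \<le> g v" "\<And>t. u < t \<Longrightarrow> t < v \<Longrightarrow> a < g t \<and> g t < b"
proof -
  let ?A = "{t \<in> {p..q}. g t \<le> a}"
  have compact: "compact ({c..q} \<inter> g -` T)" if "p \<le> c" "closed T" for c T
  proof -
    have "closed ({c..q} \<inter> g -` T)"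
      by (rule continuous_closed_preimage[OF continuous_on_subset[OF g]]) (use that in auto)
    then show ?thesis
      by (metis compact_Int_closed compact_Icc inf.left_idem)
  qed
  have "?A = {p..q} \<inter> g -` {..a}" by auto
  then have "compact ?A"
    using compact[of p "{..a}"] by simp
  moreover have "p \<in> ?A"
    using assms by auto
  ultimately obtain u where u: "u \<in> ?A" "\<And>t. t \<in> ?A \<Longrightarrow> t \<le> u"
    using compact_attains_sup[of ?A] by blast
  let ?B = "{t \<in> {u..q}. b \<le> g t}"
  have "?B = {u..q} \<inter> g -` {b..}" by auto
  then have "compact ?B"
    using compact[of u "{b..}"] u by simp
  moreover have "q \<in> ?B"
    using assms u by auto
  ultimately obtain v where v: "v \<in> ?B" "\<And>t. t \<in> ?B \<Longrightarrow> v \<le> t"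
    using compact_attains_inf[of ?B] by blast
  show ?thesis
  proof
    show "a < g t \<and> g t < b" if "u < t" "t < v" for t
      using u(1) u(2)[of t] v(1) v(2)[of t] that by force
  qed (use u v in auto)
qed

text \<open>In the variable ln t, the integral of |t g'|^n / t is that of the n-th power of the
  slope of \<open>g\<close>. The tangent inequality at slope \<open>m\<close> is integrated over the
  crossing [u, v], where \<open>g\<close> rises by at least b - a and ln t by at most L.\<close>

lemma ray_energy_ge:
  fixes g g' :: "real \<Rightarrow> real" and m :: real and F :: "real \<Rightarrow> ennreal"
  assumes der: "\<And>t. t \<in> {1..q} \<Longrightarrow> (g has_real_derivative g' t) (at t)"
    and cont: "continuous_on {1..q} g'"
    and "1 \<le> q" "q \<le> exp L" "g 1 \<le> a" "b \<le> g q" "a < b" "0 < m" "0 < n"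
    and F: "\<And>t. 1 < t \<Longrightarrow> t < q \<Longrightarrow> a < g t \<Longrightarrow> g t < b \<Longrightarrow> ennreal (\<bar>t * g' t\<bar> ^ n / t) \<le> F t"
  shows "ennreal (n * m ^ (n - 1) * (b - a) - (real n - 1) * m ^ n * L) \<le> (\<integral>\<^sup>+t. indicator {1..exp L} t * F t \<partial>lborel)"
proof -
  have "continuous_on {1..q} g"
    using der by (auto intro!: continuous_at_imp_continuous_on DERIV_isCont[OF der])
  from ray_crossing[OF this \<open>1 \<le> q\<close> \<open>g 1 \<le> a\<close> \<open>b \<le> g q\<close> \<open>a < b\<close>]
  obtain u v where uv: "1 \<le> u" "u \<le> v" "v \<le> q" "g u \<le> a" "b \<le> g v"
    and in_ab: "\<And>t. u < t \<Longrightarrow> t < v \<Longrightarrow> a < g t \<and> g t < b"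
    by metis
  \<comment> \<open>The tangent inequality divided by \<open>t\<close>: \<open>?l\<close> lies below
    \<open>?s\<close> and has an explicit antiderivative.\<close>
  let ?l = "\<lambda>t. n * m ^ (n - 1) * g' t - (real n - 1) * m ^ n * (1 / t)"
  let ?s = "\<lambda>t. \<bar>t * g' t\<bar> ^ n / t"
  have "(?l has_integral (n * m ^ (n - 1) * g v - (real n - 1) * m ^ n * ln v) -
      (n * m ^ (n - 1) * g u - (real n - 1) * m ^ n * ln u)) {u..v}"
  proof (rule fundamental_theorem_of_calculus)
    fix t assume t: "t \<in> {u..v}"
    have "((\<lambda>t. n * m ^ (n - 1) * g t - (real n - 1) * m ^ n * ln t) has_real_derivative ?l t) (at t)"
      using t uv by (auto intro!: derivative_eq_intros der)
    then show "((\<lambda>t. n * m ^ (n - 1) * g t - (real n - 1) * m ^ n * ln t) has_vector_derivative ?l t) (at t within {u..v})"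
      by (simp add: has_real_derivative_iff_has_vector_derivative has_vector_derivative_at_within)
  qed (use uv in auto)
  moreover have "?s integrable_on {u..v}"
    using uv by (intro integrable_continuous_interval continuous_intros continuous_on_subset[OF cont]) auto
  then obtain I where I: "(?s has_integral I) {u..v}"
    by blast
  moreover have "?l t \<le> ?s t" if "t \<in> {u..v}" for t
  proof -
    have t: "0 < t" using that uv by auto
    have "n * m ^ (n - 1) * (t * g' t) - (real n - 1) * m ^ n \<le> n * m ^ (n - 1) * \<bar>t * g' t\<bar> - (real n - 1) * m ^ n"
      using \<open>0 < m\<close> by (intro diff_right_mono mult_left_mono) auto
    also have "\<dots> \<le> \<bar>t * g' t\<bar> ^ n"
      by (rule young_power) (use \<open>0 < m\<close> in auto)
    finally have "(n * m ^ (n - 1) * (t * g' t) - (real n - 1) * m ^ n) / t \<le> ?s t"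
      using t by (intro divide_right_mono) auto
    then show ?thesis
      using t by (simp add: diff_divide_distrib)
  qed
  ultimately have le_I: "(n * m ^ (n - 1) * g v - (real n - 1) * m ^ n * ln v) -
      (n * m ^ (n - 1) * g u - (real n - 1) * m ^ n * ln u) \<le> I"
    by (rule has_integral_le)
  have "ln v - ln u \<le> L"
  proof -
    have "ln v \<le> ln (exp L)"
      using uv \<open>q \<le> exp L\<close> by (subst ln_le_cancel_iff) auto
    moreover have "0 \<le> ln u" using uv by simp
    ultimately show ?thesis by simp
  qed
  then have "n * m ^ (n - 1) * (b - a) - (real n - 1) * m ^ n * L \<le>
      n * m ^ (n - 1) * (g v - g u) - (real n - 1) * m ^ n * (ln v - ln u)"
    using uv \<open>0 < m\<close> \<open>0 < n\<close> by (intro diff_mono mult_left_mono) auto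
  also have "\<dots> \<le> I"
    using le_I by (simp add: algebra_simps)
  finally have "ennreal (n * m ^ (n - 1) * (b - a) - (real n - 1) * m ^ n * L) \<le> ennreal I"
    by (rule ennreal_leI)
  \<comment> \<open>The bound on \<open>F\<close> is available only strictly inside the crossing, so
    the endpoints are dropped.\<close>
  also have "(?s has_integral I) {u<..<v}"
    using I has_integral_open_interval[of ?s I u v] by simp
  then have "ennreal I = (\<integral>\<^sup>+t. ennreal (indicator {u<..<v} t * ?s t) \<partial>lborel)"
    by (rule nn_integral_has_integral_lebesgue[symmetric, rotated]) (use uv in auto)
  also have "\<dots> \<le> (\<integral>\<^sup>+t. indicator {1..exp L} t * F t \<partial>lborel)"
    using uv \<open>q \<le> exp L\<close> by (intro nn_integral_mono) (auto simp: indicator_def in_ab intro!: F)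
  finally show ?thesis .
qed

section \<open>The energy inequality for an annulus\<close>

lemma continuous_on_det_blinfun:
  fixes f' :: "'a::topological_space \<Rightarrow> ((real^'n) \<Rightarrow>\<^sub>L (real^'n))"
  assumes "continuous_on S f'"
  shows "continuous_on S (\<lambda>x. det (matrix (blinfun_apply (f' x))))"
  unfolding det_def matrix_def using assms
  by (auto intro!: continuous_intros)

text \<open>The energy of \<open>ln \<bar>f\<bar>\<close> is only ever used on the open set \<open>A\<close> where \<open>M < \<bar>f x\<bar> < M exp N\<close>, so no
  truncation of \<open>ln \<bar>f\<bar>\<close> is needed. The free parameter \<open>m\<close> is the slope at which Young's inequality is
  linearized.\<close>

lemma annulus_energy_inequality:
  fixes f :: "real^'n \<Rightarrow> real^'n" and f' :: "real^'n \<Rightarrow> ((real^'n) \<Rightarrow>\<^sub>L (real^'n))" and m :: real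
  assumes "0 < s" "0 < R" and R: "R \<le> s * exp L" "s * exp 1 \<le> R"
    and der: "\<And>x. x \<in> cball 0 R \<Longrightarrow> (f has_derivative blinfun_apply (f' x)) (at x)"
    and cont: "continuous_on (cball 0 R) f'"
    and inj: "inj_on f (cball 0 R)" and "f 0 = 0"
    and qc: "\<And>x. x \<in> cball 0 R \<Longrightarrow> norm (f' x) ^ CARD('n) \<le> K * det (matrix (blinfun_apply (f' x)))" and "0 \<le> K"
    and "0 < M" "0 < N" and inner: "\<And>x. x \<in> cball 0 (s * exp 1) \<Longrightarrow> norm (f x) \<le> M"
    and outer: "\<And>x. norm x = R \<Longrightarrow> M * exp (real N) \<le> norm (f x)"
    and "0 < m"
  shows "CARD('n) * m ^ (CARD('n) - 1) * N - (real CARD('n) - 1) * m ^ CARD('n) * L \<le> K * N"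
proof -
  define n where "n = CARD('n)"
  have n: "0 < n" by (simp add: n_def)
  define A where "A = {x \<in> ball 0 R. M < norm (f x) \<and> norm (f x) < M * exp (real N)}"
  define \<phi> where "\<phi> = (\<lambda>y::real^'n. 1 / norm y ^ n)"
  define J where "J = (\<lambda>x. indicator A x * (\<bar>det (matrix (blinfun_apply (f' x)))\<bar> * \<phi> (f x)))"
  define c where "c = n * m ^ (n - 1) * N - (real n - 1) * m ^ n * L"
  have "continuous_on (cball 0 R) f"
    using der has_derivative_continuous continuous_at_imp_continuous_on by blast
  then have cont_f: "continuous_on (ball 0 R) f"
    by (rule continuous_on_subset) auto
  have "open {y::real^'n. M < norm y \<and> norm y < M * exp (real N)}"
    by (intro open_Collect_conj open_Collect_less continuous_intros)
  from continuous_open_preimage[OF cont_f open_ball this] have "open A"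
    by (simp add: A_def vimage_def Int_def)
  have A_sub: "A \<subseteq> cball 0 R"
    by (auto simp: A_def)
  have "open (f ` A)"
    by (rule invariance_of_domain[OF continuous_on_subset[OF cont_f] \<open>open A\<close> inj_on_subset[OF inj A_sub]])
       (auto simp: A_def)
  have [measurable]: "J \<in> borel_measurable borel"
  proof -
    have "continuous_on A (\<lambda>x. \<bar>det (matrix (blinfun_apply (f' x)))\<bar> * \<phi> (f x))"
      unfolding \<phi>_def using \<open>0 < M\<close>
      by (auto intro!: continuous_intros continuous_on_det_blinfun continuous_on_subset[OF cont A_sub]
           continuous_on_subset[OF cont_f]) (auto simp: A_def)
    from borel_measurable_continuous_on_indicator[OF _ this] \<open>open A\<close> show ?thesis
      by (simp add: J_def)
  qed
  have mass: "shell_mass TYPE(real^'n) = ennreal (enn2real (shell_mass TYPE(real^'n)))"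
    using shell_mass_finite[where 'a="real^'n"] by (simp add: less_top)
  have "(\<integral>\<^sup>+y. ennreal (indicator (f ` A) y * \<phi> y) \<partial>lborel) \<le>
      (\<integral>\<^sup>+(y::real^'n). ennreal (indicator {y. M < norm y \<and> norm y \<le> M * exp (real N)} y * (1 / norm y ^ DIM(real^'n))) \<partial>lborel)"
    by (intro nn_integral_mono) (auto simp: indicator_def A_def \<phi>_def n_def)
  also have "\<dots> = of_nat N * shell_mass TYPE(real^'n)"
    by (rule nn_integral_annulus) fact
  finally have image_le: "(\<integral>\<^sup>+y. ennreal (indicator (f ` A) y * \<phi> y) \<partial>lborel) \<le> of_nat N * shell_mass TYPE(real^'n)" .
  also have "\<dots> < \<infinity>"
    using shell_mass_finite[where 'a="real^'n"] by (auto simp: ennreal_mult_less_top of_nat_less_top)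
  finally obtain \<beta> where \<beta>: "0 \<le> \<beta>" "(\<integral>\<^sup>+y. ennreal (indicator (f ` A) y * \<phi> y) \<partial>lborel) = ennreal \<beta>"
    by (auto simp: less_top elim!: ennreal_cases)
  have "(\<integral>\<^sup>+x. ennreal (J x) \<partial>lborel) = ennreal \<beta>"
    unfolding J_def
  proof (rule nn_integral_change_of_variables)
    show "(\<lambda>x. indicator A x * (\<bar>det (matrix (blinfun_apply (f' x)))\<bar> * \<phi> (f x))) \<in> borel_measurable borel"
      using \<open>J \<in> _\<close> by (simp add: J_def)
    show "(f has_derivative blinfun_apply (f' x)) (at x within A)" if "x \<in> A" for x
      using der that A_sub has_derivative_at_withinI by blast
  qed (use \<open>open A\<close> \<open>open (f ` A)\<close> inj_on_subset[OF inj A_sub] \<beta> in \<open>auto simp: \<phi>_def\<close>)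
  with image_le \<beta> have J_le: "(\<integral>\<^sup>+x. ennreal (J x) \<partial>lborel) \<le> of_nat N * shell_mass TYPE(real^'n)"
    by simp
  have ray: "ennreal c * ennreal (1 / norm x ^ n) \<le>
      (\<integral>\<^sup>+t. ennreal (indicator {1..exp L} t * t ^ (n - 1)) * ennreal (K * J (t *\<^sub>R x)) \<partial>lborel)" (is "?l \<le> ?r")
    if "x \<in> shell s" for x
  proof -
    have x: "s < norm x" "norm x \<le> s * exp 1"
      using that by (auto simp: shell_def)
    then have x0: "0 < norm x" using \<open>0 < s\<close> by linarith
    \<comment> \<open>The ray through \<open>x\<close> leaves the ball of radius \<open>R\<close> at
      time \<open>q\<close>. As s < |x| \<le> s e, the bounds on \<open>R\<close> give 1 \<le> q
      \<le> exp L.\<close>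
    define q where "q = R / norm x"
    define g where "g = (\<lambda>t. ln (norm (f (t *\<^sub>R x))))"
    define g' where "g' = (\<lambda>t. (f (t *\<^sub>R x) \<bullet> f' (t *\<^sub>R x) x) / norm (f (t *\<^sub>R x)) ^ 2)"
    have in_cball: "t *\<^sub>R x \<in> cball 0 R" if "t \<in> {1..q}" for t
      using that x0 by (simp add: q_def field_simps)
    have f_nz: "f (t *\<^sub>R x) \<noteq> 0" if "t \<in> {1..q}" for t
    proof
      assume "f (t *\<^sub>R x) = 0"
      then have "t *\<^sub>R x = 0"
        using inj_onD[OF inj, of "t *\<^sub>R x" 0] in_cball[OF that] \<open>f 0 = 0\<close> \<open>0 < R\<close> by simp
      then show False using that x0 by auto
    qed
    \<comment> \<open>Since |t g' t| \<le> t |x| |f'| / |f|, the energy density carries the factor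
      |x|^n. Dividing by it afterwards produces the weight 1 / |x|^n of the shell mass.\<close>
    have "ennreal (n * m ^ (n - 1) * (ln (M * exp N) - ln M) - (real n - 1) * m ^ n * L) \<le>
      (\<integral>\<^sup>+t. indicator {1..exp L} t * ennreal (norm x ^ n * (t ^ (n - 1) * (K * J (t *\<^sub>R x)))) \<partial>lborel)"
    proof (rule ray_energy_ge)
      show "(g has_real_derivative g' t) (at t)" if "t \<in> {1..q}" for t
      proof -
        have "((\<lambda>t. f (t *\<^sub>R x)) has_derivative (\<lambda>d. f' (t *\<^sub>R x) (d *\<^sub>R x))) (at t)"
          by (rule has_derivative_compose[where g=f and f="\<lambda>t. t *\<^sub>R x"])
             (auto intro!: derivative_eq_intros der in_cball that)
        from has_derivative_compose[OF this has_derivative_norm[OF f_nz[OF that]]]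
        have "((\<lambda>t. norm (f (t *\<^sub>R x))) has_real_derivative
            f' (t *\<^sub>R x) x \<bullet> sgn (f (t *\<^sub>R x))) (at t)"
          by (simp add: has_field_derivative_def blinfun.scaleR_right mult_commute_abs)
        from DERIV_chain2[OF DERIV_ln_divide this] f_nz[OF that] show ?thesis
          by (simp add: g_def g'_def sgn_div_norm power2_eq_square inner_commute inverse_eq_divide)
      qed
      show "continuous_on {1..q} g'"
        unfolding g'_def using f_nz in_cball
        by (auto intro!: continuous_intros continuous_on_compose2[OF \<open>continuous_on (cball 0 R) f\<close>]
            continuous_on_compose2[OF cont])
      show "1 \<le> q"
        using x x0 R by (simp add: q_def field_simps)
      show "q \<le> exp L"
      proof -
        have "R \<le> norm x * exp L"
          using R(1) x(1) by (meson exp_ge_zero less_imp_le mult_right_mono order_trans)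
        then show ?thesis using x0 by (simp add: q_def field_simps)
      qed
      show "g 1 \<le> ln M"
        using inner[of x] x f_nz[of 1] \<open>1 \<le> q\<close> \<open>0 < M\<close> by (simp add: g_def)
      have "norm (q *\<^sub>R x) = R"
        using x0 \<open>0 < R\<close> by (simp add: q_def)
      then show "ln (M * exp N) \<le> g q"
        unfolding g_def using outer \<open>0 < M\<close> f_nz[of q] \<open>1 \<le> q\<close> by (subst ln_le_cancel_iff) auto
      show "ln M < ln (M * exp N)"
        using \<open>0 < M\<close> \<open>0 < N\<close> by simp
      fix t assume t: "1 < t" "t < q" "ln M < g t" "g t < ln (M * exp N)"
      then have "t \<in> {1..q}" by simp
      note nz = f_nz[OF this] and cb = in_cball[OF this]
      have "t * norm x < R"
        using t x0 by (simp add: q_def field_simps)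
      then have tA: "t *\<^sub>R x \<in> A"
        using t nz \<open>0 < M\<close> by (simp add: A_def g_def)
      let ?f = "f (t *\<^sub>R x)"
      let ?f' = "f' (t *\<^sub>R x)"
      have "\<bar>g' t\<bar> \<le> norm ?f' * norm x / norm ?f"
      proof -
        have "\<bar>?f \<bullet> ?f' x\<bar> \<le> norm ?f * (norm ?f' * norm x)"
          by (intro order_trans[OF Cauchy_Schwarz_ineq2] mult_left_mono norm_blinfun) auto
        then show ?thesis
          using nz by (simp add: g'_def power2_eq_square field_simps abs_mult)
      qed
      then have "t * \<bar>g' t\<bar> \<le> t * (norm ?f' * norm x / norm ?f)"
        using t by (intro mult_left_mono) auto
      then have "\<bar>t * g' t\<bar> ^ n \<le> (t * (norm ?f' * norm x / norm ?f)) ^ n"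
        using t by (intro power_mono) (simp_all add: abs_mult)
      also have "\<dots> = t ^ n * norm x ^ n * \<phi> ?f * norm ?f' ^ n"
        by (simp add: power_mult_distrib power_divide \<phi>_def)
      also have "\<dots> \<le> t ^ n * norm x ^ n * \<phi> ?f * (K * \<bar>det (matrix (blinfun_apply ?f'))\<bar>)"
      proof (rule mult_left_mono)
        have "K * det (matrix (blinfun_apply ?f')) \<le> K * \<bar>det (matrix (blinfun_apply ?f'))\<bar>"
          using \<open>0 \<le> K\<close> by (intro mult_left_mono) auto
        with qc[OF cb] show "norm ?f' ^ n \<le> K * \<bar>det (matrix (blinfun_apply ?f'))\<bar>"
          by (simp add: n_def)
      qed (use t in \<open>auto simp: \<phi>_def\<close>)
      finally have "\<bar>t * g' t\<bar> ^ n / t \<le> t ^ n * norm x ^ n * \<phi> ?f * (K * \<bar>det (matrix (blinfun_apply ?f'))\<bar>) / t"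
        using t by (intro divide_right_mono) auto
      also have "\<dots> = norm x ^ n * (t ^ (n - 1) * (K * J (t *\<^sub>R x)))"
        using tA t n by (cases n) (auto simp: J_def)
      finally show "ennreal (\<bar>t * g' t\<bar> ^ n / t) \<le> ennreal (norm x ^ n * (t ^ (n - 1) * (K * J (t *\<^sub>R x))))"
        by (rule ennreal_leI)
    qed (use \<open>0 < m\<close> n in auto)
    also have "\<dots> = (\<integral>\<^sup>+t. ennreal (norm x ^ n) * (ennreal (indicator {1..exp L} t * t ^ (n - 1)) * ennreal (K * J (t *\<^sub>R x))) \<partial>lborel)"
      using \<open>0 \<le> K\<close>
      by (intro nn_integral_cong) (auto simp: indicator_def ennreal_mult'[symmetric] ennreal_mult''[symmetric] J_def \<phi>_def)
    also have "\<dots> = ennreal (norm x ^ n) * ?r"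
      by (rule nn_integral_cmult) measurable
    finally have "ennreal c \<le> ennreal (norm x ^ n) * ?r"
      using \<open>0 < M\<close> by (simp add: c_def ln_mult)
    then have "ennreal (1 / norm x ^ n) * ennreal c \<le> ennreal (1 / norm x ^ n) * (ennreal (norm x ^ n) * ?r)"
      by (rule mult_left_mono) auto
    also have "\<dots> = ?r"
      using x0 by (simp add: mult.assoc[symmetric] ennreal_mult'[symmetric])
    finally show ?thesis
      by (simp add: mult.commute)
  qed
  \<comment> \<open>The ray estimate is integrated over the starting shell: \<open>c\<close> times
    the shell mass on the left, and on the right, by ray averaging and change of variables, at most
    K N times the same mass.\<close>
  have "ennreal c * shell_mass TYPE(real^'n) =
      ennreal c * (\<integral>\<^sup>+(x::real^'n). ennreal (indicator (shell s) x * (1 / norm x ^ n)) \<partial>lborel)"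
    using nn_integral_shell[OF \<open>0 < s\<close>, where 'a="real^'n"] by (simp add: n_def)
  also have "\<dots> = (\<integral>\<^sup>+(x::real^'n). ennreal c * ennreal (indicator (shell s) x * (1 / norm x ^ n)) \<partial>lborel)"
    by (rule nn_integral_cmult[symmetric]) measurable
  also have "\<dots> \<le> (\<integral>\<^sup>+x. indicator (shell s) x *
      (\<integral>\<^sup>+t. ennreal (indicator {1..exp L} t * t ^ (n - 1)) * ennreal (K * J (t *\<^sub>R x)) \<partial>lborel) \<partial>lborel)"
    by (intro nn_integral_mono) (use ray in \<open>auto simp: indicator_def\<close>)
  also have "\<dots> \<le> (\<integral>\<^sup>+x. ennreal (K * J x) \<partial>lborel)"
    using nn_integral_radial_le[of "\<lambda>x. ennreal (K * J x)" s "exp L"] \<open>0 < s\<close> by (simp add: n_def)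
  also have "\<dots> = ennreal K * (\<integral>\<^sup>+x. ennreal (J x) \<partial>lborel)"
    using \<open>0 \<le> K\<close> by (simp add: ennreal_mult' nn_integral_cmult)
  also have "\<dots> \<le> ennreal K * (of_nat N * shell_mass TYPE(real^'n))"
    by (intro mult_left_mono J_le) auto
  finally have "ennreal c * shell_mass TYPE(real^'n) \<le> ennreal (K * N) * shell_mass TYPE(real^'n)"
    using \<open>0 \<le> K\<close> by (simp add: ennreal_mult' mult.assoc ennreal_of_nat_eq_real_of_nat)
  moreover have "0 < enn2real (shell_mass TYPE(real^'n))"
    using shell_mass_pos[where 'a="real^'n"] shell_mass_finite[where 'a="real^'n"]
    by (simp add: enn2real_positive_iff)
  \<comment> \<open>A negative \<open>c\<close> becomes 0 under \<open>ennreal\<close>, which loses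
    nothing, for then c \<le> 0 \<le> K N.\<close>
  ultimately have "c \<le> K * N"
    using \<open>0 \<le> K\<close>
    by (subst (asm) (1 2) mass)
       (auto simp: ennreal_mult''[symmetric] ennreal_le_iff2 mult_le_0_iff intro: order_trans[of c 0])
  then show ?thesis
    by (simp add: c_def n_def)
qed

section \<open>The limit of small inner radius\<close>

text \<open>The ball of radius R e^(-k) is mapped into one of radius proportional to e^(-mk), so a
  target annulus of logarithmic thickness mk - p is paid for by a source of thickness k + 1. The
  energy inequality with slope \<open>m\<close> becomes m^n k \<le> K m k + O(1), and k tends to
  infinity.\<close>

lemma vanishing_order_le:
  fixes f :: "real^'n \<Rightarrow> real^'n" and f' :: "real^'n \<Rightarrow> ((real^'n) \<Rightarrow>\<^sub>L (real^'n))"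
  assumes "0 < R"
    and der: "\<And>x. x \<in> cball 0 R \<Longrightarrow> (f has_derivative blinfun_apply (f' x)) (at x)"
    and cont: "continuous_on (cball 0 R) f'"
    and inj: "inj_on f (cball 0 R)" and "f 0 = 0"
    and qc: "\<And>x. x \<in> cball 0 R \<Longrightarrow> norm (f' x) ^ CARD('n) \<le> K * det (matrix (blinfun_apply (f' x)))" and "0 \<le> K"
    and "0 < C" and van: "\<And>x. x \<in> cball 0 R \<Longrightarrow> norm (f x) \<le> C * norm x ^ m" and "0 < m"
  shows "real m ^ (CARD('n) - 1) \<le> K"
proof -
  define n where "n = CARD('n)"
  have n: "0 < n" by (simp add: n_def)
  have "continuous_on (sphere 0 R) (\<lambda>x. norm (f x))"
    using der has_derivative_continuous
    by (intro continuous_intros continuous_at_imp_continuous_on) fastforce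
  moreover have "sphere (0::real^'n) R \<noteq> {}"
    using \<open>0 < R\<close> by simp
  ultimately obtain z where z: "norm z = R" and z_min: "\<And>x. norm x = R \<Longrightarrow> norm (f z) \<le> norm (f x)"
    using continuous_attains_inf[of "sphere 0 R" "\<lambda>x. norm (f x)"] by (auto simp: dist_norm)
  have "f z \<noteq> 0"
    using inj_onD[OF inj, of z 0] z \<open>0 < R\<close> \<open>f 0 = 0\<close> by auto
  \<comment> \<open>\<open>p\<close> absorbs the ratio between C R^m and the minimum of |f| on the
    sphere of radius \<open>R\<close>. Being independent of \<open>k\<close>, it disappears in the
    limit.\<close>
  obtain p :: nat where "C * R ^ m / norm (f z) < real p"
    using reals_Archimedean2 by blast
  then have p: "C * R ^ m / norm (f z) \<le> exp (real p)"
    using exp_ge_add_one_self[of "real p"] by linarith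
  \<comment> \<open>The subtraction is truncated, hence the guard \<open>p < m * k\<close>
    below.\<close>
  let ?c = "\<lambda>k. real (m * k - p)"
  have key: "n * real m ^ (n - 1) * ?c k - (real n - 1) * real m ^ n * (k + 1) \<le> K * ?c k" if "p < m * k" for k :: nat
  proof -
    \<comment> \<open>The exponent is k + 1 because the starting shell has logarithmic thickness 1
      itself: its outer radius is R e^(-k).\<close>
    let ?s = "R * exp (- real (k + 1))"
    let ?M = "C * (R * exp (- real k)) ^ m"
    have s_e: "?s * exp 1 = R * exp (- real k)"
      by (simp add: mult.assoc exp_add[symmetric])
    have "n * real m ^ (n - 1) * real (m * k - p) - (real n - 1) * real m ^ n * real (k + 1) \<le> K * real (m * k - p)"
      unfolding n_def
    proof (rule annulus_energy_inequality[where s="?s" and M="?M" and R=R and f=f and f'=f'])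
      show "R \<le> ?s * exp (real (k + 1))" "?s * exp 1 \<le> R"
        using \<open>0 < R\<close> by (simp_all add: mult.assoc exp_add[symmetric])
      show "norm (f x) \<le> ?M" if "x \<in> cball 0 (?s * exp 1)" for x
      proof -
        have x: "norm x \<le> R * exp (- real k)" using that unfolding s_e by simp
        also have "\<dots> \<le> R" using \<open>0 < R\<close> by simp
        finally have "norm (f x) \<le> C * norm x ^ m" using van by simp
        also have "\<dots> \<le> ?M" using x \<open>0 < C\<close> by (intro mult_left_mono power_mono) auto
        finally show ?thesis .
      qed
      show "?M * exp (real (m * k - p)) \<le> norm (f x)" if "norm x = R" for x
      proof -
        have "?M * exp (real (m * k - p)) = C * R ^ m * exp (- real p)"
        proof -
          have "exp (- real k) ^ m * exp (real (m * k - p)) = exp (- real p)"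
            using \<open>p < m * k\<close>
            unfolding exp_of_nat_mult[of m "- real k", symmetric] exp_add[symmetric]
            by (simp add: of_nat_diff)
          then show ?thesis
            by (simp add: power_mult_distrib)
        qed
        also have "\<dots> \<le> norm (f z)"
          using p \<open>f z \<noteq> 0\<close> by (simp add: exp_minus field_simps)
        finally show ?thesis using z_min[OF that] by simp
      qed
      show "0 < ?M" using \<open>0 < R\<close> \<open>0 < C\<close> by simp
    qed (use assms that in auto)
    then show ?thesis by simp
  qed
  have "real m ^ n \<le> K * real m"
  proof (rule field_le_epsilon)
    fix e :: real assume "0 < e"
    \<comment> \<open>All that does not grow with \<open>k\<close>: the loss \<open>p\<close> in the
      target and the extra unit in k + 1.\<close>
    let ?B = "n * real m ^ (n - 1) * p + (real n - 1) * real m ^ n"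
    obtain k :: nat where k: "(\<bar>?B\<bar> + p + 1) / e + p + 1 \<le> real k"
      using real_arch_simple by blast
    have "0 \<le> (\<bar>?B\<bar> + p + 1) / e" using \<open>0 < e\<close> by simp
    with k have "p < k" by linarith
    also have "k \<le> m * k" using \<open>0 < m\<close> by simp
    finally have pk: "p < m * k" .
    have mn: "real m ^ n = real m ^ (n - 1) * real m"
      using n by (simp add: power_eq_if)
    have "?B \<le> e * k"
    proof -
      have "(\<bar>?B\<bar> + p + 1) / e \<le> real k" using k by linarith
      then show ?thesis using \<open>0 < e\<close> by (simp add: field_simps)
    qed
    moreover have "n * real m ^ (n - 1) * (real m * k - p) - (real n - 1) * real m ^ n * (k + 1) \<le> K * (real m * k)"
    proof -
      have "K * ?c k \<le> K * (real m * k)"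
        using \<open>0 \<le> K\<close> pk by (intro mult_left_mono) (auto simp: of_nat_diff)
      with key[OF pk] pk show ?thesis by (simp add: of_nat_diff)
    qed
    moreover have "n * real m ^ (n - 1) * (real m * k - p) - (real n - 1) * real m ^ n * (k + 1) = real m ^ n * k - ?B"
      unfolding mn by (simp add: algebra_simps)
    ultimately have "real m ^ n * k \<le> K * (real m * k) + e * k"
      by linarith
    then have "real m ^ n * k \<le> (K * real m + e) * k"
      by (simp add: algebra_simps)
    then show "real m ^ n \<le> K * real m + e"
      using \<open>p < k\<close> by simp
  qed
  moreover have "real m ^ n = real m ^ (n - 1) * real m"
    using n by (simp add: power_eq_if)
  ultimately show ?thesis
    using \<open>0 < m\<close> by (simp add: n_def)
qed

section \<open>Nonvanishing of the Jacobian\<close>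

text \<open>By continuity of \<open>f'\<close> the points violating the inequality form an open set.
  It is null, because the derivative in the almost everywhere condition coincides with
  \<open>f'\<close>, and a null open set is empty.\<close>

lemma quasiconformal_distortion:
  fixes f :: "real^'n \<Rightarrow> real^'n" and f' :: "real^'n \<Rightarrow> ((real^'n) \<Rightarrow>\<^sub>L (real^'n))"
  assumes "open U" and qc: "quasiconformal_on K U f"
    and der: "\<And>x. x \<in> U \<Longrightarrow> (f has_derivative blinfun_apply (f' x)) (at x)"
    and cont: "continuous_on U f'" and "x \<in> U"
  shows "norm (f' x) ^ CARD('n) \<le> K * det (matrix (blinfun_apply (f' x)))"
proof (rule ccontr)
  let ?q = "\<lambda>x. K * det (matrix (blinfun_apply (f' x))) - norm (f' x) ^ CARD('n)"
  let ?S = "U \<inter> ?q -` {..<0}"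
  assume "\<not> ?thesis"
  then have "x \<in> ?S" using \<open>x \<in> U\<close> by simp
  have "open ?S"
    by (intro continuous_open_preimage \<open>open U\<close> continuous_intros continuous_on_det_blinfun cont open_lessThan)
  then have "?S \<in> sets lebesgue" by auto
  have "AE x in lebesgue. x \<in> U \<longrightarrow>
        (\<exists>f'. (f has_derivative f') (at x) \<and> onorm f' ^ CARD('n) \<le> K * det (matrix f') \<and>
              det (matrix f') \<le> K * min_stretch f' ^ CARD('n))"
    using qc by (simp add: quasiconformal_on_def)
  then have "AE x in lebesgue. x \<notin> ?S"
  proof (rule eventually_mono, intro notI)
    fix y assume y: "y \<in> U \<longrightarrow>
        (\<exists>f'. (f has_derivative f') (at y) \<and> onorm f' ^ CARD('n) \<le> K * det (matrix f') \<and>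
              det (matrix f') \<le> K * min_stretch f' ^ CARD('n))" "y \<in> ?S"
    then obtain h where "(f has_derivative h) (at y)" "onorm h ^ CARD('n) \<le> K * det (matrix h)"
      by auto
    moreover from this y have "h = blinfun_apply (f' y)"
      using has_derivative_unique der by blast
    ultimately show False
      using y by (simp add: norm_blinfun.rep_eq)
  qed
  then have "negligible ?S"
    using \<open>?S \<in> sets lebesgue\<close> by (simp add: negligible_iff_null_sets AE_iff_null_sets)
  with open_not_negligible[OF \<open>open ?S\<close>] \<open>x \<in> ?S\<close> show False
    by blast
qed

lemma quadratic_vanishing:
  fixes f :: "'a::real_normed_vector \<Rightarrow> 'b::real_normed_vector" and f' :: "'a \<Rightarrow> ('a \<Rightarrow>\<^sub>L 'b)"
  assumes der: "\<And>x. x \<in> cball x0 R \<Longrightarrow> (f has_derivative blinfun_apply (f' x)) (at x)"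
    and lip: "L-lipschitz_on (cball x0 R) f'" and "f' x0 = 0" and x: "x \<in> cball x0 R"
  shows "norm (f x - f x0) \<le> L * norm (x - x0) ^ 2"
proof -
  \<comment> \<open>On this ball, rather than the one of radius \<open>R\<close>, the derivative is
    bounded by L |x - x0|; the mean value inequality contributes the second factor |x - x0|.\<close>
  let ?S = "cball x0 (norm (x - x0))"
  have sub: "?S \<subseteq> cball x0 R"
    using x by (auto simp: dist_norm norm_minus_commute)
  have "0 \<le> R" using x by (auto intro: order_trans[OF zero_le_dist])
  have "norm (f x - f x0) \<le> L * norm (x - x0) * norm (x - x0)"
  proof (rule differentiable_bound[where S="?S" and f'="\<lambda>x. blinfun_apply (f' x)"])
    show "(f has_derivative blinfun_apply (f' y)) (at y within ?S)" if "y \<in> ?S" for y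
      using der sub that has_derivative_at_withinI by blast
    show "onorm (blinfun_apply (f' y)) \<le> L * norm (x - x0)" if "y \<in> ?S" for y
    proof -
      have "dist (f' y) (f' x0) \<le> L * dist y x0"
        using lipschitz_onD[OF lip, of y x0] sub that \<open>0 \<le> R\<close> by auto
      also have "\<dots> \<le> L * norm (x - x0)"
        using that lipschitz_on_nonneg[OF lip] by (intro mult_left_mono) (auto simp: dist_commute)
      finally show ?thesis
        using \<open>f' x0 = 0\<close> by (simp add: norm_blinfun.rep_eq[symmetric] dist_norm)
    qed
  qed (auto simp: dist_norm norm_minus_commute)
  then show ?thesis
    by (simp add: power2_eq_square mult.assoc)
qed

lemma quasiconformal_det_nonzero:
  fixes f :: "real^'n \<Rightarrow> real^'n" and f' :: "real^'n \<Rightarrow> ((real^'n) \<Rightarrow>\<^sub>L (real^'n))"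
  assumes "open U" and qc: "quasiconformal_on K U f" and K: "K < 2 ^ (CARD('n) - 1)"
    and der: "\<And>x. x \<in> U \<Longrightarrow> (f has_derivative blinfun_apply (f' x)) (at x)"
    and cont: "continuous_on U f'"
    and lip: "\<And>x. x \<in> U \<Longrightarrow> \<exists>r>0. \<exists>L. L-lipschitz_on (ball x r \<inter> U) f'"
    and "x0 \<in> U"
  shows "det (matrix (blinfun_apply (f' x0))) \<noteq> 0"
proof
  assume "det (matrix (blinfun_apply (f' x0))) = 0"
  \<comment> \<open>The distortion inequality bounds |f'|^n by K times the vanishing
    determinant.\<close>
  then have "f' x0 = 0"
    using quasiconformal_distortion[OF \<open>open U\<close> qc der cont \<open>x0 \<in> U\<close>] by (auto simp: power_le_zero_eq)
  obtain r L where "0 < r" and L: "L-lipschitz_on (ball x0 r \<inter> U) f'"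
    using lip[OF \<open>x0 \<in> U\<close>] by blast
  moreover have "open (ball x0 r \<inter> U)" "x0 \<in> ball x0 r \<inter> U"
    using \<open>open U\<close> \<open>x0 \<in> U\<close> \<open>0 < r\<close> by auto
  ultimately obtain R where "0 < R" and R: "cball x0 R \<subseteq> ball x0 r \<inter> U"
    using open_contains_cball_eq by blast
  have L_R: "L-lipschitz_on (cball x0 R) f'"
    using lipschitz_on_subset[OF L R] .
  have shift: "x0 + x \<in> cball x0 R" "x0 + x \<in> U" if "x \<in> cball 0 R" for x
    using that R by (auto simp: dist_norm)
  have "inj_on f U"
    using qc by (auto simp: quasiconformal_on_def homeomorphism_def intro: inj_on_inverseI)
  \<comment> \<open>Translations move \<open>x0\<close> and \<open>f x0\<close> to the origin. The
    order 2 is that of the quadratic bound, and \<open>L + 1\<close> is positive even if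
    \<open>L\<close> is 0.\<close>
  have "real 2 ^ (CARD('n) - 1) \<le> K"
  proof (rule vanishing_order_le[where f="\<lambda>x. f (x0 + x) - f x0" and f'="\<lambda>x. f' (x0 + x)" and R=R and C="L + 1"])
    show "((\<lambda>x. f (x0 + x) - f x0) has_derivative blinfun_apply (f' (x0 + x))) (at x)" if "x \<in> cball 0 R" for x
    proof -
      have "((\<lambda>x. f (x0 + x)) has_derivative (\<lambda>d. f' (x0 + x) d)) (at x)"
        by (rule has_derivative_compose[where g=f and f="\<lambda>x. x0 + x"])
           (auto intro!: derivative_eq_intros der shift that)
      then show ?thesis
        by (auto intro!: derivative_eq_intros)
    qed
    show "continuous_on (cball 0 R) (\<lambda>x. f' (x0 + x))"
      by (intro continuous_on_compose2[OF cont] continuous_intros) (use R in auto)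
    show "inj_on (\<lambda>x. f (x0 + x) - f x0) (cball 0 R)"
    proof (rule inj_onI)
      fix x y assume x: "x \<in> cball 0 R" and y: "y \<in> cball 0 R" and "f (x0 + x) - f x0 = f (x0 + y) - f x0"
      then have "x0 + x = x0 + y"
        using inj_onD[OF \<open>inj_on f U\<close> _ shift(2)[OF x] shift(2)[OF y]] by simp
      then show "x = y" by simp
    qed
    show "norm (f' (x0 + x)) ^ CARD('n) \<le> K * det (matrix (blinfun_apply (f' (x0 + x))))" if "x \<in> cball 0 R" for x
      by (rule quasiconformal_distortion[OF \<open>open U\<close> qc der cont shift(2)[OF that]])
    show "0 \<le> K" using qc by (simp add: quasiconformal_on_def)
    show "0 < L + 1" using lipschitz_on_nonneg[OF L] by simp
    show "norm (f (x0 + x) - f x0) \<le> (L + 1) * norm x ^ 2" if "x \<in> cball 0 R" for x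
    proof -
      have "norm (f (x0 + x) - f x0) \<le> L * norm (x0 + x - x0) ^ 2"
        by (rule quadratic_vanishing[OF der L_R \<open>f' x0 = 0\<close> shift(1)[OF that]]) (use R in blast)
      then show ?thesis
        by (rule order_trans) (simp add: distrib_right)
    qed
  qed (use \<open>0 < R\<close> in auto)
  with K show False by simp
qed


section \<open>Bi-Lipschitz estimates on compact sets\<close>

lemma compact_locally_bounded_ratio:
  fixes A B :: "'a::topological_space \<Rightarrow> real"
  assumes "compact S" and nonneg: "\<And>p. p \<in> S \<Longrightarrow> 0 \<le> B p"
    and local: "\<And>p. p \<in> S \<Longrightarrow> \<exists>U c. open U \<and> p \<in> U \<and> (\<forall>q\<in>U \<inter> S. A q \<le> c * B q)"
  obtains c where "1 \<le> c" "\<And>q. q \<in> S \<Longrightarrow> A q \<le> c * B q"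
proof -
  obtain U c where U: "\<And>p. p \<in> S \<Longrightarrow> open (U p) \<and> p \<in> U p \<and> (\<forall>q\<in>U p \<inter> S. A q \<le> c p * B q)"
    using local by metis
  obtain T where T: "T \<subseteq> S" "finite T" "S \<subseteq> (\<Union>p\<in>T. U p)"
    by (rule compactE_image[OF \<open>compact S\<close>, of S U]) (use U in auto)
  show ?thesis
  proof
    show "1 \<le> Max (insert 1 (c ` T))"
      using T by simp
    fix q assume "q \<in> S"
    with T obtain p where p: "p \<in> T" "q \<in> U p" by blast
    then have "A q \<le> c p * B q"
      using U T \<open>q \<in> S\<close> by blast
    also have "\<dots> \<le> Max (insert 1 (c ` T)) * B q"
      using p T nonneg[OF \<open>q \<in> S\<close>] by (intro mult_right_mono) auto
    finally show "A q \<le> Max (insert 1 (c ` T)) * B q" .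
  qed
qed

text \<open>Off the diagonal, continuity keeps \<open>B\<close> away from 0 near a given pair. On
  the diagonal both functions may vanish, so a local bound is assumed there; a finite subcover of S
  \<times> S combines the two kinds of bounds.\<close>

lemma compact_pairs_bounded_ratio:
  fixes A B :: "'a::metric_space \<Rightarrow> 'a \<Rightarrow> real"
  assumes "compact S"
    and cont: "continuous_on (S \<times> S) (\<lambda>(x, y). A x y)" "continuous_on (S \<times> S) (\<lambda>(x, y). B x y)"
    and pos: "\<And>x y. x \<in> S \<Longrightarrow> y \<in> S \<Longrightarrow> x \<noteq> y \<Longrightarrow> 0 < B x y" and nonneg: "\<And>x y. 0 \<le> B x y"
    and diag: "\<And>x. x \<in> S \<Longrightarrow> \<exists>\<delta>>0. \<exists>c. \<forall>u\<in>ball x \<delta>. \<forall>v\<in>ball x \<delta>. A u v \<le> c * B u v"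
  obtains c where "1 \<le> c" "\<And>x y. x \<in> S \<Longrightarrow> y \<in> S \<Longrightarrow> A x y \<le> c * B x y"
proof -
  obtain c where "1 \<le> c" "\<And>q. q \<in> S \<times> S \<Longrightarrow> (\<lambda>(x, y). A x y) q \<le> c * (\<lambda>(x, y). B x y) q"
  proof (rule compact_locally_bounded_ratio[where A="\<lambda>(x, y). A x y" and B="\<lambda>(x, y). B x y" and S="S \<times> S"])
    fix p assume p: "p \<in> S \<times> S"
    obtain x y where xy: "p = (x, y)" "x \<in> S" "y \<in> S"
      using p by auto
    show "\<exists>U c. open U \<and> p \<in> U \<and> (\<forall>q\<in>U \<inter> S \<times> S. (case q of (x, y) \<Rightarrow> A x y) \<le> c * (case q of (x, y) \<Rightarrow> B x y))"
    proof (cases "x = y")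
      case True
      obtain \<delta> c where "0 < \<delta>" "\<forall>u\<in>ball x \<delta>. \<forall>v\<in>ball x \<delta>. A u v \<le> c * B u v"
        using diag[OF xy(2)] by blast
      then show ?thesis
        using xy True by (intro exI[of _ "ball x \<delta> \<times> ball x \<delta>"] exI[of _ c]) (auto intro: open_Times)
    next
      case False
      define a where "a = \<bar>A x y\<bar> + 1"
      define b where "b = B x y / 2"
      have b: "0 < b" "b < B x y"
        using pos[OF xy(2,3) False] by (auto simp: b_def)
      obtain U where U: "open U" "U \<inter> (S \<times> S) = (\<lambda>(x, y). A x y) -` {..<a} \<inter> (S \<times> S)"
        using cont(1) unfolding continuous_on_open_invariant by (metis open_lessThan)
      obtain V where V: "open V" "V \<inter> (S \<times> S) = (\<lambda>(x, y). B x y) -` {b<..} \<inter> (S \<times> S)"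
        using cont(2) unfolding continuous_on_open_invariant by (metis open_greaterThan)
      have "A x y < a" by (simp add: a_def abs_if)
      then have "p \<in> U \<inter> (S \<times> S)" "p \<in> V \<inter> (S \<times> S)"
        unfolding U(2) V(2) using b xy by auto
      moreover have "A u v \<le> a / b * B u v" if "(u, v) \<in> U \<inter> V" "u \<in> S" "v \<in> S" for u v
      proof -
        have "A u v < a" "b < B u v"
          using U(2) V(2) that by auto
        moreover have "0 \<le> a" by (simp add: a_def)
        ultimately have "A u v * b \<le> a * B u v"
          using b by (meson less_imp_le mult_mono mult_right_mono mult_left_mono order_trans)
        then show ?thesis using b by (simp add: field_simps)
      qed
      ultimately show ?thesis
        using U V by (intro exI[of _ "U \<inter> V"] exI[of _ "a / b"]) auto
    qed
  qed (use \<open>compact S\<close> nonneg in \<open>auto intro: compact_Times\<close>)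
  then show ?thesis
    using that by auto
qed

text \<open>If \<open>B\<close> bounds the injective linear map \<open>f' x\<close> from below, then
  the difference of \<open>f\<close> and \<open>f' x\<close> is B/2-Lipschitz near \<open>x\<close>.
  This perturbation costs at most half of \<open>B\<close>, whence the constants norm (f' x) + B/2
  above and 2/B below.\<close>

lemma local_bi_lipschitz:
  fixes f :: "'a::euclidean_space \<Rightarrow> 'b::euclidean_space" and f' :: "'a \<Rightarrow> ('a \<Rightarrow>\<^sub>L 'b)"
  assumes "open U" and der: "\<And>x. x \<in> U \<Longrightarrow> (f has_derivative blinfun_apply (f' x)) (at x)"
    and cont: "continuous_on U f'" and "x \<in> U" and inj: "inj (blinfun_apply (f' x))"
  obtains \<delta> c where "0 < \<delta>" "1 \<le> c"
    "\<And>u v. u \<in> ball x \<delta> \<Longrightarrow> v \<in> ball x \<delta> \<Longrightarrow> dist (f u) (f v) \<le> c * dist u v \<and> dist u v \<le> c * dist (f u) (f v)"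
proof -
  obtain B where "0 < B" and B: "\<And>w. B * norm w \<le> norm (f' x w)"
    using linear_inj_bounded_below_pos[OF bounded_linear.linear[OF blinfun.bounded_linear_right] inj] by metis
  have "isCont f' x"
    using cont \<open>open U\<close> \<open>x \<in> U\<close> by (simp add: continuous_on_eq_continuous_at)
  then obtain d where "0 < d" and d: "\<And>y. dist y x < d \<Longrightarrow> dist (f' y) (f' x) < B / 2"
    unfolding continuous_at_eps_delta using \<open>0 < B\<close> by (metis half_gt_zero)
  obtain e where "0 < e" "ball x e \<subseteq> U"
    using \<open>open U\<close> \<open>x \<in> U\<close> open_contains_ball by metis
  define \<delta> where "\<delta> = min d e"
  define c where "c = Max {1, norm (f' x) + B / 2, 2 / B}"
  have lin: "norm (f u - f v - f' x (u - v)) \<le> B / 2 * norm (u - v)" if "u \<in> ball x \<delta>" "v \<in> ball x \<delta>" for u v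
  proof -
    have "norm ((f u - f' x u) - (f v - f' x v)) \<le> B / 2 * norm (u - v)"
    proof (rule differentiable_bound[where S="ball x \<delta>" and f'="\<lambda>y. blinfun_apply (f' y - f' x)"])
      fix y assume y: "y \<in> ball x \<delta>"
      then have "y \<in> U" using \<open>ball x e \<subseteq> U\<close> by (auto simp: \<delta>_def)
      then show "((\<lambda>y. f y - f' x y) has_derivative blinfun_apply (f' y - f' x)) (at y within ball x \<delta>)"
        by (auto intro!: derivative_eq_intros has_derivative_at_withinI[OF der] simp: blinfun.diff_left)
      show "onorm (blinfun_apply (f' y - f' x)) \<le> B / 2"
        using d[of y] y by (simp add: \<delta>_def norm_blinfun.rep_eq[symmetric] dist_norm norm_minus_commute)
    qed (use that in auto)
    then show ?thesis
      by (simp add: blinfun.diff_right algebra_simps)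
  qed
  show ?thesis
  proof
    show "0 < \<delta>" using \<open>0 < d\<close> \<open>0 < e\<close> by (simp add: \<delta>_def)
    show "1 \<le> c" by (simp add: c_def)
    fix u v assume uv: "u \<in> ball x \<delta>" "v \<in> ball x \<delta>"
    have "norm (f u - f v) \<le> norm (f' x (u - v)) + B / 2 * norm (u - v)"
      using lin[OF uv] norm_triangle_ineq2[of "f u - f v" "f' x (u - v)"] by linarith
    also have "\<dots> \<le> (norm (f' x) + B / 2) * norm (u - v)"
      using norm_blinfun[of "f' x" "u - v"] by (simp add: distrib_right)
    also have "\<dots> \<le> c * norm (u - v)"
      by (intro mult_right_mono) (auto simp: c_def)
    finally have upper: "norm (f u - f v) \<le> c * norm (u - v)" .
    have "B * norm (u - v) \<le> norm (f u - f v) + B / 2 * norm (u - v)"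
      using lin[OF uv] B[of "u - v"] norm_triangle_ineq2[of "f' x (u - v)" "f u - f v"]
      by (simp add: norm_minus_commute)
    then have "norm (u - v) \<le> 2 / B * norm (f u - f v)"
      using \<open>0 < B\<close> by (simp add: field_simps)
    also have "\<dots> \<le> c * norm (f u - f v)"
      by (intro mult_right_mono) (auto simp: c_def)
    finally show "dist (f u) (f v) \<le> c * dist u v \<and> dist u v \<le> c * dist (f u) (f v)"
      using upper by (simp add: dist_norm)
  qed
qed

text \<open>The bound on ratios is applied twice, with the two distances exchanged. Injectivity on
  \<open>U\<close> gives positivity off the diagonal, and injectivity of the derivative settles the
  diagonal.\<close>

lemma compact_bi_lipschitz:
  fixes f :: "'a::euclidean_space \<Rightarrow> 'b::euclidean_space" and f' :: "'a \<Rightarrow> ('a \<Rightarrow>\<^sub>L 'b)"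
  assumes "open U" and der: "\<And>x. x \<in> U \<Longrightarrow> (f has_derivative blinfun_apply (f' x)) (at x)"
    and cont: "continuous_on U f'" and inj': "\<And>x. x \<in> U \<Longrightarrow> inj (blinfun_apply (f' x))"
    and inj: "inj_on f U" and "compact S" "S \<subseteq> U"
  obtains c where "1 \<le> c"
    "\<And>x y. x \<in> S \<Longrightarrow> y \<in> S \<Longrightarrow> dist (f x) (f y) \<le> c * dist x y \<and> dist x y \<le> c * dist (f x) (f y)"
proof -
  have "continuous_on S f"
    using \<open>S \<subseteq> U\<close> by (intro continuous_at_imp_continuous_on ballI has_derivative_continuous[OF der]) auto
  then have cont_f: "continuous_on (S \<times> S) (\<lambda>(x, y). dist (f x) (f y))"
    unfolding case_prod_unfold
    by (intro continuous_on_dist continuous_on_compose2[OF \<open>continuous_on S f\<close>] continuous_intros) auto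
  have cont_d: "continuous_on (S \<times> S) (\<lambda>(x, y). dist x y)"
    by (auto simp: case_prod_unfold intro!: continuous_intros)
  have pos: "0 < dist (f x) (f y)" if "x \<in> S" "y \<in> S" "x \<noteq> y" for x y
    using inj_onD[OF inj, of x y] that \<open>S \<subseteq> U\<close> by auto
  have local: "\<exists>\<delta>>0. \<exists>c. \<forall>u\<in>ball x \<delta>. \<forall>v\<in>ball x \<delta>. dist (f u) (f v) \<le> c * dist u v \<and> dist u v \<le> c * dist (f u) (f v)"
    if "x \<in> S" for x
  proof -
    have "x \<in> U" using that \<open>S \<subseteq> U\<close> by blast
    obtain \<delta> c where "0 < \<delta>"
      "\<And>u v. u \<in> ball x \<delta> \<Longrightarrow> v \<in> ball x \<delta> \<Longrightarrow> dist (f u) (f v) \<le> c * dist u v \<and> dist u v \<le> c * dist (f u) (f v)"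
      by (rule local_bi_lipschitz[OF \<open>open U\<close> der cont \<open>x \<in> U\<close> inj'[OF \<open>x \<in> U\<close>]]) (assumption, rule that)
    then show ?thesis
      by (intro exI[of _ \<delta>] exI[of _ c] conjI ballI) auto
  qed
  have local1: "\<exists>\<delta>>0. \<exists>c. \<forall>u\<in>ball x \<delta>. \<forall>v\<in>ball x \<delta>. dist (f u) (f v) \<le> c * dist u v"
    and local2: "\<exists>\<delta>>0. \<exists>c. \<forall>u\<in>ball x \<delta>. \<forall>v\<in>ball x \<delta>. dist u v \<le> c * dist (f u) (f v)"
    if "x \<in> S" for x
    using local[OF that] by meson+
  obtain c where c: "1 \<le> c" "\<And>x y. x \<in> S \<Longrightarrow> y \<in> S \<Longrightarrow> dist (f x) (f y) \<le> c * dist x y"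
    by (rule compact_pairs_bounded_ratio[OF \<open>compact S\<close> cont_f cont_d _ _ local1]) auto
  obtain c' where c': "1 \<le> c'" "\<And>x y. x \<in> S \<Longrightarrow> y \<in> S \<Longrightarrow> dist x y \<le> c' * dist (f x) (f y)"
    by (rule compact_pairs_bounded_ratio[OF \<open>compact S\<close> cont_d cont_f pos _ local2]) auto
  show ?thesis
  proof
    show "1 \<le> max c c'" using c by simp
    fix x y assume xy: "x \<in> S" "y \<in> S"
    have "c * dist x y \<le> max c c' * dist x y" "c' * dist (f x) (f y) \<le> max c c' * dist (f x) (f y)"
      by (intro mult_right_mono; simp)+
    with c(2)[OF xy] c'(2)[OF xy]
    show "dist (f x) (f y) \<le> max c c' * dist x y \<and> dist x y \<le> max c c' * dist (f x) (f y)"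
      by linarith
  qed
qed


section \<open>Arc length and line integrals under Lipschitz maps\<close>

lemma sum_lessThan_add:
  fixes h :: "nat \<Rightarrow> 'a::comm_monoid_add"
  shows "sum h {..<m + k} = sum h {..<m} + (\<Sum>i<k. h (m + i))"
  by (induction k) (auto simp: add.assoc)

lemma polygonal_sums_concat:
  assumes "x \<in> polygonal_sums \<gamma> a b" "y \<in> polygonal_sums \<gamma> b c"
  shows "x + y \<in> polygonal_sums \<gamma> a c"
proof -
  obtain m t where t: "x = (\<Sum>i<m. dist (\<gamma> (t i)) (\<gamma> (t (Suc i))))" "\<And>i. i < m \<Longrightarrow> t i \<le> t (Suc i)" "t 0 = a" "t m = b"
    using assms(1) by (auto simp: polygonal_sums_def)
  obtain k u where u: "y = (\<Sum>i<k. dist (\<gamma> (u i)) (\<gamma> (u (Suc i))))" "\<And>i. i < k \<Longrightarrow> u i \<le> u (Suc i)" "u 0 = b" "u k = c"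
    using assms(2) by (auto simp: polygonal_sums_def)
  \<comment> \<open>At \<open>i = m\<close> both sequences equal \<open>b\<close>, so shifting by
    \<open>m\<close> recovers \<open>u\<close> from index 0 on.\<close>
  define v where "v = (\<lambda>i. if i \<le> m then t i else u (i - m))"
  have v: "v (m + i) = u i" for i
    using t u by (auto simp: v_def)
  have "(\<Sum>i<m + k. dist (\<gamma> (v i)) (\<gamma> (v (Suc i)))) = x + y"
  proof -
    have "(\<Sum>i<m. dist (\<gamma> (v i)) (\<gamma> (v (Suc i)))) = x"
      unfolding t(1) by (rule sum.cong) (auto simp: v_def)
    moreover have "(\<Sum>i<k. dist (\<gamma> (v (m + i))) (\<gamma> (v (Suc (m + i))))) = y"
      unfolding u(1) using v by (metis add_Suc_right)
    ultimately show ?thesis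
      by (simp add: sum_lessThan_add)
  qed
  moreover have "v i \<le> v (Suc i)" if "i < m + k" for i
  proof (cases "i < m")
    case True
    then show ?thesis using t by (simp add: v_def)
  next
    case False
    then have "i = m + (i - m)" "i - m < k" using that by auto
    then show ?thesis using u(2)[of "i - m"] v by (metis add_Suc_right)
  qed
  moreover have "v 0 = a" "v (m + k) = c"
    using t u v by (auto simp: v_def)
  ultimately show ?thesis
    unfolding polygonal_sums_def by (intro CollectI exI[of _ "m + k"] exI[of _ v]) auto
qed

text \<open>Clamping with \<open>min b\<close> and \<open>max b\<close> splits a partition at
  \<open>b\<close> without inserting an index: a step on one side of \<open>b\<close> has a zero
  term in the other sum, and a step across \<open>b\<close> is covered by the triangle inequality
  through \<open>\<gamma> b\<close>.\<close>

lemma sum_dist_split_le: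
  fixes \<gamma> :: "real \<Rightarrow> 'a::metric_space" and t :: "nat \<Rightarrow> real"
  assumes "\<And>i. i < m \<Longrightarrow> t i \<le> t (Suc i)"
  shows "(\<Sum>i<m. dist (\<gamma> (t i)) (\<gamma> (t (Suc i)))) \<le>
    (\<Sum>i<m. dist (\<gamma> (min b (t i))) (\<gamma> (min b (t (Suc i))))) +
    (\<Sum>i<m. dist (\<gamma> (max b (t i))) (\<gamma> (max b (t (Suc i)))))"
proof -
  have "dist (\<gamma> (t i)) (\<gamma> (t (Suc i))) \<le>
      dist (\<gamma> (min b (t i))) (\<gamma> (min b (t (Suc i)))) + dist (\<gamma> (max b (t i))) (\<gamma> (max b (t (Suc i))))"
    if "i < m" for i
    using assms[OF that] dist_triangle[of "\<gamma> (t i)" "\<gamma> (t (Suc i))" "\<gamma> b"]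
    by (auto simp: min_def max_def)
  then show ?thesis
    unfolding sum.distrib[symmetric] by (intro sum_mono) auto
qed

lemma polygonal_sums_restrict:
  assumes "\<And>i. i < m \<Longrightarrow> t i \<le> t (Suc i)" "t 0 = a" "t m = c" "a \<le> b" "b \<le> c"
  shows "(\<Sum>i<m. dist (\<gamma> (min b (t i))) (\<gamma> (min b (t (Suc i))))) \<in> polygonal_sums \<gamma> a b"
    and "(\<Sum>i<m. dist (\<gamma> (max b (t i))) (\<gamma> (max b (t (Suc i))))) \<in> polygonal_sums \<gamma> b c"
proof -
  show "(\<Sum>i<m. dist (\<gamma> (min b (t i))) (\<gamma> (min b (t (Suc i))))) \<in> polygonal_sums \<gamma> a b"
    unfolding polygonal_sums_def
    by (intro CollectI exI[of _ m] exI[of _ "\<lambda>i. min b (t i)"]) (use assms in \<open>auto intro: min.coboundedI2 simp: min_def; force\<close>)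
  show "(\<Sum>i<m. dist (\<gamma> (max b (t i))) (\<gamma> (max b (t (Suc i))))) \<in> polygonal_sums \<gamma> b c"
    unfolding polygonal_sums_def
    by (intro CollectI exI[of _ m] exI[of _ "\<lambda>i. max b (t i)"]) (use assms in \<open>auto simp: max_def; force\<close>)
qed

lemma dist_in_polygonal_sums: "a \<le> b \<Longrightarrow> dist (\<gamma> a) (\<gamma> b) \<in> polygonal_sums \<gamma> a b"
  unfolding polygonal_sums_def
  by (intro CollectI exI[of _ 1] exI[of _ "\<lambda>i. if i = 0 then a else b"]) auto

lemma polygonal_sums_points:
  assumes "\<And>i. i < m \<Longrightarrow> t i \<le> t (Suc i)" "i \<le> m"
  shows "(t 0 :: real) \<le> t i \<and> t i \<le> t m"
proof
  show "t 0 \<le> t i"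
    using \<open>i \<le> m\<close> by (induction i) (use assms in \<open>auto intro: order_trans simp: Suc_le_eq\<close>)
  show "t i \<le> t m"
    using \<open>i \<le> m\<close> by (induction rule: inc_induct) (use assms in \<open>auto intro: order_trans\<close>)
qed

section \<open>Arc length of a rectifiable path and its parametrization\<close>

locale rectifiable =
  fixes \<gamma> :: "real \<Rightarrow> 'a::metric_space"
  assumes rectifiable: "rectifiable_path \<gamma>"
begin

lemma bdd_polygonal_sums:
  assumes "0 \<le> a" "a \<le> b" "b \<le> 1"
  shows "bdd_above (polygonal_sums \<gamma> a b)"
proof -
  obtain B where B: "\<And>x. x \<in> polygonal_sums \<gamma> 0 1 \<Longrightarrow> x \<le> B"
    using rectifiable by (auto simp: rectifiable_path_def bdd_above_def)
  have "x \<le> B" if "x \<in> polygonal_sums \<gamma> a b" for x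
  proof -
    have "dist (\<gamma> 0) (\<gamma> a) + x + dist (\<gamma> b) (\<gamma> 1) \<in> polygonal_sums \<gamma> 0 1"
      using assms that by (meson polygonal_sums_concat dist_in_polygonal_sums)
    from B[OF this] show ?thesis
      using zero_le_dist[of "\<gamma> 0" "\<gamma> a"] zero_le_dist[of "\<gamma> b" "\<gamma> 1"] by linarith
  qed
  then show ?thesis
    by (auto simp: bdd_above_def)
qed

lemma polygonal_sum_le_arc_length:
  assumes "0 \<le> a" "a \<le> b" "b \<le> 1" "x \<in> polygonal_sums \<gamma> a b"
  shows "x \<le> arc_length \<gamma> a b"
  unfolding arc_length_def using assms by (intro cSup_upper bdd_polygonal_sums)

lemma dist_le_arc_length:
  assumes "0 \<le> a" "a \<le> b" "b \<le> 1"
  shows "dist (\<gamma> a) (\<gamma> b) \<le> arc_length \<gamma> a b"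
  using assms by (intro polygonal_sum_le_arc_length dist_in_polygonal_sums)

lemma arc_length_nonneg:
  assumes "0 \<le> a" "a \<le> b" "b \<le> 1"
  shows "0 \<le> arc_length \<gamma> a b"
  using dist_le_arc_length[OF assms] zero_le_dist order_trans by blast

text \<open>Clamping gives one inequality, concatenation of partitions the other.\<close>

lemma arc_length_add:
  assumes "0 \<le> a" "a \<le> b" "b \<le> c" "c \<le> 1"
  shows "arc_length \<gamma> a c = arc_length \<gamma> a b + arc_length \<gamma> b c"
proof (rule antisym)
  have ne: "polygonal_sums \<gamma> u v \<noteq> {}" if "u \<le> v" for u v
    using dist_in_polygonal_sums[OF that] by blast
  show "arc_length \<gamma> a c \<le> arc_length \<gamma> a b + arc_length \<gamma> b c"
    unfolding arc_length_def[of \<gamma> a c]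
  proof (rule cSup_least)
    fix x assume "x \<in> polygonal_sums \<gamma> a c"
    then obtain m t where t: "x = (\<Sum>i<m. dist (\<gamma> (t i)) (\<gamma> (t (Suc i))))" "\<And>i. i < m \<Longrightarrow> t i \<le> t (Suc i)" "t 0 = a" "t m = c"
      by (auto simp: polygonal_sums_def)
    note x = polygonal_sums_restrict[of m t, OF t(2-4) assms(2,3), of \<gamma>]
    show "x \<le> arc_length \<gamma> a b + arc_length \<gamma> b c"
      using sum_dist_split_le[of m t \<gamma> b, OF t(2)] assms t(1)
        polygonal_sum_le_arc_length[OF _ _ _ x(1)] polygonal_sum_le_arc_length[OF _ _ _ x(2)]
      by linarith
  qed (use assms ne in auto)
  have "x + y \<le> arc_length \<gamma> a c" if "x \<in> polygonal_sums \<gamma> a b" "y \<in> polygonal_sums \<gamma> b c" for x y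
    using assms that by (intro polygonal_sum_le_arc_length polygonal_sums_concat) auto
  then have "y \<le> arc_length \<gamma> a c - x" if "x \<in> polygonal_sums \<gamma> a b" "y \<in> polygonal_sums \<gamma> b c" for x y
    using that by (simp add: algebra_simps)
  then have "arc_length \<gamma> b c \<le> arc_length \<gamma> a c - x" if "x \<in> polygonal_sums \<gamma> a b" for x
    unfolding arc_length_def[of \<gamma> b c] using that ne assms by (intro cSup_least) auto
  then have "x \<le> arc_length \<gamma> a c - arc_length \<gamma> b c" if "x \<in> polygonal_sums \<gamma> a b" for x
    using that by (simp add: algebra_simps)
  then have "arc_length \<gamma> a b \<le> arc_length \<gamma> a c - arc_length \<gamma> b c"
    unfolding arc_length_def[of \<gamma> a b] using ne assms by (intro cSup_least) auto
  then show "arc_length \<gamma> a b + arc_length \<gamma> b c \<le> arc_length \<gamma> a c"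
    by simp
qed

lemma arc_length_refl [simp]: "0 \<le> a \<Longrightarrow> a \<le> 1 \<Longrightarrow> arc_length \<gamma> a a = 0"
  using arc_length_add[of a a a] by simp

text \<open>A polygonal sum with \<open>m\<close> vertices that is almost the total length has at most \<open>m\<close> nonzero
  terms in a short interval, and each of them is small by uniform continuity.\<close>

lemma arc_length_uniformly_small:
  assumes "0 < e"
  obtains d where "0 < d" "\<And>s t. 0 \<le> s \<Longrightarrow> s \<le> t \<Longrightarrow> t \<le> 1 \<Longrightarrow> t - s < d \<Longrightarrow> arc_length \<gamma> s t < e"
proof -
  have "arc_length \<gamma> 0 1 - e / 2 < Sup (polygonal_sums \<gamma> 0 1)"
    using \<open>0 < e\<close> by (simp add: arc_length_def)
  then obtain x where x: "x \<in> polygonal_sums \<gamma> 0 1" "arc_length \<gamma> 0 1 - e / 2 < x"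
    using dist_in_polygonal_sums[of 0 1 \<gamma>] by (subst (asm) less_cSup_iff) (auto intro: bdd_polygonal_sums)
  then obtain m u where u: "x = (\<Sum>i<m. dist (\<gamma> (u i)) (\<gamma> (u (Suc i))))" "\<And>i. i < m \<Longrightarrow> u i \<le> u (Suc i)" "u 0 = 0" "u m = 1"
    by (auto simp: polygonal_sums_def)
  have "uniformly_continuous_on {0..1} \<gamma>"
    using rectifiable by (auto simp: rectifiable_path_def path_def intro: compact_uniformly_continuous)
  \<comment> \<open>The \<open>m\<close> terms together stay below e/2; the + 1 makes this strict
    and covers m = 0.\<close>
  moreover have "0 < e / (2 * (real m + 1))"
    using \<open>0 < e\<close> by simp
  ultimately obtain d where "0 < d"
    and d: "\<And>p q. p \<in> {0..1} \<Longrightarrow> q \<in> {0..1} \<Longrightarrow> dist p q < d \<Longrightarrow> dist (\<gamma> p) (\<gamma> q) < e / (2 * (real m + 1))"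
    unfolding uniformly_continuous_on_def by metis
  show ?thesis
  proof
    fix s t :: real assume st: "0 \<le> s" "s \<le> t" "t \<le> 1" "t - s < d"
    \<comment> \<open>Clamping at \<open>s\<close> and again at \<open>t\<close> spreads
      \<open>x\<close> over [0, s], [s, t] and [t, 1]. The outer parts are at most the arc lengths
      there, so the length of [s, t] exceeds the middle part by less than e/2.\<close>
    let ?w = "\<lambda>i. max s (u i)"
    have w: "?w i \<le> ?w (Suc i)" if "i < m" for i
      using u(2)[OF that] by auto
    have w0: "?w 0 = s" "?w m = 1"
      using u st by auto
    have "x \<le> (\<Sum>i<m. dist (\<gamma> (min s (u i))) (\<gamma> (min s (u (Suc i))))) + (\<Sum>i<m. dist (\<gamma> (?w i)) (\<gamma> (?w (Suc i))))"
      unfolding u(1) using u(2) by (rule sum_dist_split_le)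
    moreover have "(\<Sum>i<m. dist (\<gamma> (min s (u i))) (\<gamma> (min s (u (Suc i))))) \<le> arc_length \<gamma> 0 s"
      using st u by (intro polygonal_sum_le_arc_length polygonal_sums_restrict(1)[where c=1]) auto
    moreover have "(\<Sum>i<m. dist (\<gamma> (?w i)) (\<gamma> (?w (Suc i)))) \<le>
        (\<Sum>i<m. dist (\<gamma> (min t (?w i))) (\<gamma> (min t (?w (Suc i))))) + (\<Sum>i<m. dist (\<gamma> (max t (?w i))) (\<gamma> (max t (?w (Suc i)))))"
      using w by (rule sum_dist_split_le)
    moreover have "(\<Sum>i<m. dist (\<gamma> (max t (?w i))) (\<gamma> (max t (?w (Suc i))))) \<le> arc_length \<gamma> t 1"
      using st w w0 by (intro polygonal_sum_le_arc_length polygonal_sums_restrict(2)[where a=s]) auto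
    moreover have "(\<Sum>i<m. dist (\<gamma> (min t (?w i))) (\<gamma> (min t (?w (Suc i))))) \<le> (\<Sum>i<m. e / (2 * (real m + 1)))"
    proof (rule sum_mono)
      fix i
      have "min t (max s v) \<in> {s..t}" for v using st by auto
      then show "dist (\<gamma> (min t (?w i))) (\<gamma> (min t (?w (Suc i)))) \<le> e / (2 * (real m + 1))"
        using st by (intro less_imp_le d) (fastforce simp: dist_real_def abs_real_def min_def max_def)+
    qed
    moreover have "(\<Sum>i<m. e / (2 * (real m + 1))) < e / 2"
      using \<open>0 < e\<close> by (simp add: field_simps)
    moreover have "arc_length \<gamma> 0 1 = arc_length \<gamma> 0 s + arc_length \<gamma> s t + arc_length \<gamma> t 1"
      using st arc_length_add[of 0 s 1] arc_length_add[of s t 1] by simp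
    ultimately show "arc_length \<gamma> s t < e"
      using x(2) by linarith
  qed fact
qed

lemma continuous_on_arc_length: "continuous_on {0..1} (arc_length \<gamma> 0)"
  unfolding continuous_on_iff
proof (intro ballI allI impI)
  fix x e :: real assume x: "x \<in> {0..1}" and "0 < e"
  obtain d where "0 < d" and d: "\<And>s t. 0 \<le> s \<Longrightarrow> s \<le> t \<Longrightarrow> t \<le> 1 \<Longrightarrow> t - s < d \<Longrightarrow> arc_length \<gamma> s t < e"
    using arc_length_uniformly_small[OF \<open>0 < e\<close>] by blast
  have "dist (arc_length \<gamma> 0 y) (arc_length \<gamma> 0 x) < e" if y: "y \<in> {0..1}" "dist y x < d" for y
  proof (cases "x \<le> y")
    case True
    then show ?thesis
      using d[of x y] arc_length_add[of 0 x y] arc_length_nonneg[of x y] x y by (auto simp: dist_real_def)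
  next
    case False
    then show ?thesis
      using d[of y x] arc_length_add[of 0 y x] arc_length_nonneg[of y x] x y by (auto simp: dist_real_def)
  qed
  with \<open>0 < d\<close> show "\<exists>d>0. \<forall>x'\<in>{0..1}. dist x' x < d \<longrightarrow> dist (arc_length \<gamma> 0 x') (arc_length \<gamma> 0 x) < e"
    by blast
qed

text \<open>Names the time chosen inside \<open>arc_length_param\<close>. As a function of arc
  length it may jump where the path rests.\<close>

definition param_time :: "real \<Rightarrow> real" where
  "param_time s = (SOME t. t \<in> {0..1} \<and> arc_length \<gamma> 0 t = s)"

lemma arc_length_param_eq: "arc_length_param \<gamma> s = \<gamma> (param_time s)"
  by (simp add: arc_length_param_def param_time_def)

lemma param_time:
  assumes "s \<in> {0..arc_length \<gamma> 0 1}"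
  shows "param_time s \<in> {0..1}" "arc_length \<gamma> 0 (param_time s) = s"
proof -
  have "\<exists>t\<ge>0. t \<le> 1 \<and> arc_length \<gamma> 0 t = s"
    using assms by (intro IVT' continuous_on_arc_length) auto
  then have "\<exists>t. t \<in> {0..1} \<and> arc_length \<gamma> 0 t = s" by auto
  from someI_ex[OF this] show "param_time s \<in> {0..1}" "arc_length \<gamma> 0 (param_time s) = s"
    by (auto simp: param_time_def)
qed

text \<open>Makes the chosen time harmless: times of equal arc length have the same image under
  \<open>\<gamma>\<close>, and the parametrization by arc length is 1-Lipschitz.\<close>

lemma dist_le_arc_length_diff:
  assumes "s \<in> {0..1}" "t \<in> {0..1}"
  shows "dist (\<gamma> s) (\<gamma> t) \<le> \<bar>arc_length \<gamma> 0 s - arc_length \<gamma> 0 t\<bar>"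
proof (cases "s \<le> t")
  case True
  then show ?thesis
    using arc_length_add[of 0 s t] dist_le_arc_length[of s t] assms by auto
next
  case False
  then show ?thesis
    using arc_length_add[of 0 t s] dist_le_arc_length[of t s] assms by (auto simp: dist_commute)
qed

lemma arc_length_le_total: "t \<in> {0..1} \<Longrightarrow> arc_length \<gamma> 0 t \<in> {0..arc_length \<gamma> 0 1}"
  using arc_length_add[of 0 t 1] arc_length_nonneg[of 0 t] arc_length_nonneg[of t 1] by auto

lemma arc_length_param_arc_length:
  assumes "t \<in> {0..1}"
  shows "arc_length_param \<gamma> (arc_length \<gamma> 0 t) = \<gamma> t"
  using dist_le_arc_length_diff[of "param_time (arc_length \<gamma> 0 t)" t]
    param_time[OF arc_length_le_total[OF assms]] assms
  by (simp add: arc_length_param_eq)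

lemma arc_length_param_in_path_image: "s \<in> {0..arc_length \<gamma> 0 1} \<Longrightarrow> arc_length_param \<gamma> s \<in> path_image \<gamma>"
  using param_time by (auto simp: arc_length_param_eq path_image_def)

lemma continuous_on_arc_length_param: "continuous_on {0..arc_length \<gamma> 0 1} (arc_length_param \<gamma>)"
proof -
  have "dist (arc_length_param \<gamma> s) (arc_length_param \<gamma> t) \<le> dist s t"
    if "s \<in> {0..arc_length \<gamma> 0 1}" "t \<in> {0..arc_length \<gamma> 0 1}" for s t
    using dist_le_arc_length_diff[of "param_time s" "param_time t"] param_time that
    by (simp add: arc_length_param_eq dist_real_def)
  then show ?thesis
    unfolding continuous_on_iff by (meson le_less_trans)
qed

lemma continuous_on_line_integrand:
  assumes "continuous_on (path_image \<gamma>) \<rho>"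
  shows "continuous_on {0..arc_length \<gamma> 0 1} (\<lambda>s. \<rho> (arc_length_param \<gamma> s))"
  using arc_length_param_in_path_image
  by (intro continuous_on_compose2[OF assms continuous_on_arc_length_param]) auto

end

section \<open>Comparison of line integrals\<close>

text \<open>On a short interval around \<open>x\<close> the values of \<open>G\<close> differ from
  \<open>G (\<phi> x)\<close> by less than \<epsilon>, and the image interval has length at most a
  (t - s). Bisection adds up these local inequalities.\<close>

lemma integral_reparam_le:
  fixes G \<phi> :: "real \<Rightarrow> real"
  assumes G: "continuous_on {0..M} G" and "0 < a" "0 \<le> L"
    and \<phi>: "\<And>s t. 0 \<le> s \<Longrightarrow> s \<le> t \<Longrightarrow> t \<le> L \<Longrightarrow> \<phi> s \<le> \<phi> t \<and> \<phi> t - \<phi> s \<le> a * (t - s)"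
    and ends: "\<phi> 0 = 0" "\<phi> L = M" and nonneg: "\<And>u. u \<in> {0..M} \<Longrightarrow> 0 \<le> G u"
  shows "integral {0..M} G \<le> a * integral {0..L} (\<lambda>s. G (\<phi> s))"
proof (rule field_le_epsilon)
  fix e :: real assume "0 < e"
  \<comment> \<open>The accumulated error 2 a \<epsilon> L is at most \<open>e\<close>; L + 1 covers
    L = 0.\<close>
  define \<epsilon> where "\<epsilon> = e / (2 * a * (L + 1))"
  have "0 < \<epsilon>" using \<open>0 < e\<close> \<open>0 < a\<close> \<open>0 \<le> L\<close> by (simp add: \<epsilon>_def)
  have \<phi>_range: "\<phi> s \<in> {0..M}" if "0 \<le> s" "s \<le> L" for s
    using \<phi>[of 0 s] \<phi>[of s L] ends that by auto
  have "a-lipschitz_on {0..L} \<phi>"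
  proof (rule lipschitz_onI)
    show "dist (\<phi> s) (\<phi> t) \<le> a * dist s t" if "s \<in> {0..L}" "t \<in> {0..L}" for s t
      using \<phi>[of s t] \<phi>[of t s] that by (cases "s \<le> t") (auto simp: dist_real_def)
  qed (use \<open>0 < a\<close> in simp)
  then have "continuous_on {0..L} \<phi>"
    by (rule lipschitz_on_continuous_on)
  then have G\<phi>: "continuous_on {0..L} (\<lambda>s. G (\<phi> s))"
    by (rule continuous_on_compose2[OF G]) (use \<phi>_range in auto)
  have int_G: "G integrable_on {u..v}" if "0 \<le> u" "v \<le> M" for u v
    by (intro integrable_continuous_interval continuous_on_subset[OF G]) (use that in auto)
  have int_G\<phi>: "(\<lambda>s. G (\<phi> s)) integrable_on {u..v}" if "0 \<le> u" "v \<le> L" for u v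
    by (intro integrable_continuous_interval continuous_on_subset[OF G\<phi>]) (use that in auto)
  \<comment> \<open>Inherited by joined intervals and true on short ones, as \<open>Bolzano\<close>
    requires. Each of the two integrals accounts for one a \<epsilon> (t - s) of the error.\<close>
  let ?P = "\<lambda>s t. 0 \<le> s \<longrightarrow> t \<le> L \<longrightarrow>
    integral {\<phi> s..\<phi> t} G \<le> a * integral {s..t} (\<lambda>s. G (\<phi> s)) + 2 * a * \<epsilon> * (t - s)"
  have "?P 0 L"
  proof (rule Bolzano[where P="?P"])
    fix p q r assume trans: "?P p q" "?P q r" "p \<le> q" "q \<le> r"
    show "?P p r"
    proof (intro impI)
      assume b: "0 \<le> p" "r \<le> L"
      have "integral {\<phi> p..\<phi> q} G + integral {\<phi> q..\<phi> r} G = integral {\<phi> p..\<phi> r} G"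
        using trans b \<phi>[of p q] \<phi>[of q r] \<phi>_range[of p] \<phi>_range[of r]
        by (intro Henstock_Kurzweil_Integration.integral_combine int_G) auto
      moreover have "integral {p..q} (\<lambda>s. G (\<phi> s)) + integral {q..r} (\<lambda>s. G (\<phi> s)) = integral {p..r} (\<lambda>s. G (\<phi> s))"
        using trans b by (intro Henstock_Kurzweil_Integration.integral_combine int_G\<phi>) auto
      then have "a * integral {p..r} (\<lambda>s. G (\<phi> s)) = a * integral {p..q} (\<lambda>s. G (\<phi> s)) + a * integral {q..r} (\<lambda>s. G (\<phi> s))"
        by (metis distrib_left)
      moreover have "2 * a * \<epsilon> * (r - p) = 2 * a * \<epsilon> * (q - p) + 2 * a * \<epsilon> * (r - q)"
        by (simp add: algebra_simps)
      ultimately show "integral {\<phi> p..\<phi> r} G \<le> a * integral {p..r} (\<lambda>s. G (\<phi> s)) + 2 * a * \<epsilon> * (r - p)"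
        using trans b by linarith
    qed
  next
    fix x assume local: "0 \<le> x" "x \<le> L"
    have "\<phi> x \<in> {0..M}" using \<phi>_range local by simp
    then obtain \<eta> where "0 < \<eta>" and \<eta>: "\<And>y. y \<in> {0..M} \<Longrightarrow> dist y (\<phi> x) < \<eta> \<Longrightarrow> dist (G y) (G (\<phi> x)) < \<epsilon>"
      using G \<open>0 < \<epsilon>\<close> unfolding continuous_on_iff by metis
    have "?P s t" if st: "s \<le> x" "x \<le> t" "t - s < \<eta> / a" for s t
    proof (intro impI)
      assume b: "0 \<le> s" "t \<le> L"
      have "a * (t - s) < \<eta>"
        using st \<open>0 < a\<close> by (simp add: field_simps)
      then have close: "\<bar>G y - G (\<phi> x)\<bar> < \<epsilon>" if "\<phi> s \<le> y" "y \<le> \<phi> t" for y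
        using \<eta>[of y] \<phi>[of s x] \<phi>[of x t] \<phi>[of s t] \<phi>_range[of s] \<phi>_range[of t] that st b
        by (auto simp: dist_real_def)
      have "integral {\<phi> s..\<phi> t} G \<le> integral {\<phi> s..\<phi> t} (\<lambda>_. G (\<phi> x) + \<epsilon>)"
        using \<phi>_range[of s] \<phi>_range[of t] st b
        by (intro integral_le int_G) (use close in \<open>fastforce simp: abs_less_iff\<close>)+
      also have "\<dots> = (\<phi> t - \<phi> s) * (G (\<phi> x) + \<epsilon>)"
        using \<phi>[of s t] st b by simp
      also have "\<dots> \<le> (a * (t - s)) * (G (\<phi> x) + \<epsilon>)"
        using \<phi>[of s t] st b nonneg[OF \<open>\<phi> x \<in> _\<close>] \<open>0 < \<epsilon>\<close> by (intro mult_right_mono) auto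
      finally have 1: "integral {\<phi> s..\<phi> t} G \<le> a * ((t - s) * (G (\<phi> x) + \<epsilon>))"
        by simp
      have "(t - s) * (G (\<phi> x) - \<epsilon>) = integral {s..t} (\<lambda>_. G (\<phi> x) - \<epsilon>)"
        using st by simp
      also have "\<dots> \<le> integral {s..t} (\<lambda>s. G (\<phi> s))"
      proof (intro integral_le int_G\<phi>)
        fix r assume "r \<in> {s..t}"
        then have "\<bar>G (\<phi> r) - G (\<phi> x)\<bar> < \<epsilon>"
          using close[of "\<phi> r"] \<phi>[of s r] \<phi>[of r t] b by auto
        then show "G (\<phi> x) - \<epsilon> \<le> G (\<phi> r)" by linarith
      qed (use b in auto)
      finally have "a * ((t - s) * (G (\<phi> x) - \<epsilon>)) \<le> a * integral {s..t} (\<lambda>s. G (\<phi> s))"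
        using \<open>0 < a\<close> by (intro mult_left_mono) auto
      moreover have "a * ((t - s) * (G (\<phi> x) + \<epsilon>)) = a * ((t - s) * (G (\<phi> x) - \<epsilon>)) + 2 * a * \<epsilon> * (t - s)"
        by (simp add: algebra_simps)
      ultimately show "integral {\<phi> s..\<phi> t} G \<le> a * integral {s..t} (\<lambda>s. G (\<phi> s)) + 2 * a * \<epsilon> * (t - s)"
        using 1 by linarith
    qed
    moreover have "0 < \<eta> / a" using \<open>0 < \<eta>\<close> \<open>0 < a\<close> by simp
    ultimately show "\<exists>d>0. \<forall>s t. s \<le> x \<and> x \<le> t \<and> t - s < d \<longrightarrow> ?P s t" by blast
  qed fact
  then have "integral {0..M} G \<le> a * integral {0..L} (\<lambda>s. G (\<phi> s)) + 2 * a * \<epsilon> * L"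
    using \<open>0 \<le> L\<close> ends by simp
  also have "2 * a * \<epsilon> * L \<le> 2 * a * \<epsilon> * (L + 1)"
    using \<open>0 < a\<close> \<open>0 < \<epsilon>\<close> by (intro mult_left_mono) auto
  also have "\<dots> = e"
    using \<open>0 < a\<close> \<open>0 \<le> L\<close> by (simp add: \<epsilon>_def)
  finally show "integral {0..M} G \<le> a * integral {0..L} (\<lambda>s. G (\<phi> s)) + e"
    by simp
qed

lemma polygonal_sums_lipschitz:
  assumes lip: "\<And>s t. s \<in> {a..b} \<Longrightarrow> t \<in> {a..b} \<Longrightarrow> dist (\<delta> s) (\<delta> t) \<le> c * dist (\<gamma> s) (\<gamma> t)"
    and "x \<in> polygonal_sums \<delta> a b"
  obtains y where "y \<in> polygonal_sums \<gamma> a b" "x \<le> c * y"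
proof -
  obtain m t where t: "x = (\<Sum>i<m. dist (\<delta> (t i)) (\<delta> (t (Suc i))))" "\<And>i. i < m \<Longrightarrow> t i \<le> t (Suc i)" "t 0 = a" "t m = b"
    using assms(2) by (auto simp: polygonal_sums_def)
  show ?thesis
  proof
    show "(\<Sum>i<m. dist (\<gamma> (t i)) (\<gamma> (t (Suc i)))) \<in> polygonal_sums \<gamma> a b"
      using t unfolding polygonal_sums_def by blast
    have "t i \<in> {a..b}" if "i \<le> m" for i
      using polygonal_sums_points[of m t i] t that by auto
    then show "x \<le> c * (\<Sum>i<m. dist (\<gamma> (t i)) (\<gamma> (t (Suc i))))"
      unfolding t(1) sum_distrib_left by (intro sum_mono lip) auto
  qed
qed

lemma line_integral_nonneg:
  assumes "rectifiable_path \<gamma>" "continuous_on (path_image \<gamma>) \<rho>" "\<And>z. z \<in> path_image \<gamma> \<Longrightarrow> 0 \<le> \<rho> z"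
  shows "0 \<le> line_integral \<rho> \<gamma>"
proof -
  interpret rectifiable \<gamma> by standard fact
  show ?thesis
    unfolding line_integral_def
    using assms arc_length_param_in_path_image
    by (intro integral_nonneg integrable_continuous_interval continuous_on_line_integrand) auto
qed

text \<open>Two paths appear instead of a composition so that \<open>\<gamma>\<close> may also be
  the identity of [0, 1], which makes Lipschitz paths rectifiable.\<close>

lemma lipschitz_image_rectifiable:
  assumes "rectifiable_path \<gamma>" "path \<delta>" "0 \<le> c"
    and lip: "\<And>s t. s \<in> {0..1} \<Longrightarrow> t \<in> {0..1} \<Longrightarrow> dist (\<delta> s) (\<delta> t) \<le> c * dist (\<gamma> s) (\<gamma> t)"
  shows "rectifiable_path \<delta>"
proof -
  obtain B where B: "\<And>y. y \<in> polygonal_sums \<gamma> 0 1 \<Longrightarrow> y \<le> B"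
    using assms(1) by (auto simp: rectifiable_path_def bdd_above_def)
  have "x \<le> c * B" if x: "x \<in> polygonal_sums \<delta> 0 1" for x
  proof -
    obtain y where "y \<in> polygonal_sums \<gamma> 0 1" "x \<le> c * y"
      using polygonal_sums_lipschitz[OF lip x] by metis
    then show ?thesis
      using B[of y] \<open>0 \<le> c\<close> by (meson mult_left_mono order_trans)
  qed
  then show ?thesis
    using \<open>path \<delta>\<close> by (auto simp: rectifiable_path_def bdd_above_def)
qed

text \<open>The arc length parameter of the image is a monotone \<open>c\<close>-Lipschitz function of the arc length
  parameter of the original curve.\<close>

lemma line_integral_image_le:
  fixes \<gamma> :: "real \<Rightarrow> 'a::metric_space" and f :: "'a \<Rightarrow> 'b::metric_space"
  assumes \<gamma>: "rectifiable_path \<gamma>" and "path (f \<circ> \<gamma>)" and "0 < c" "0 \<le> b"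
    and lip: "\<And>x y. x \<in> path_image \<gamma> \<Longrightarrow> y \<in> path_image \<gamma> \<Longrightarrow> dist (f x) (f y) \<le> c * dist x y"
    and \<rho>: "continuous_on (path_image \<gamma>) \<rho>" and \<sigma>: "continuous_on (path_image (f \<circ> \<gamma>)) \<sigma>"
    and nonneg: "\<And>z. z \<in> path_image \<gamma> \<Longrightarrow> 0 \<le> \<sigma> (f z)"
    and le: "\<And>z. z \<in> path_image \<gamma> \<Longrightarrow> \<sigma> (f z) \<le> b * \<rho> z"
  shows "line_integral \<sigma> (f \<circ> \<gamma>) \<le> c * b * line_integral \<rho> \<gamma>"
proof -
  let ?\<delta> = "f \<circ> \<gamma>"
  have lip\<delta>: "dist (?\<delta> s) (?\<delta> t) \<le> c * dist (\<gamma> s) (\<gamma> t)" if "s \<in> {0..1}" "t \<in> {0..1}" for s t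
    using that by (auto simp: path_image_def intro: lip)
  have \<delta>: "rectifiable_path ?\<delta>"
    by (rule lipschitz_image_rectifiable[OF \<gamma> \<open>path (f \<circ> \<gamma>)\<close> less_imp_le[OF \<open>0 < c\<close>] lip\<delta>])
  interpret g: rectifiable \<gamma> by standard fact
  interpret d: rectifiable ?\<delta> by standard fact
  have arc: "arc_length ?\<delta> s t \<le> c * arc_length \<gamma> s t" if "0 \<le> s" "s \<le> t" "t \<le> 1" for s t
    unfolding arc_length_def[of ?\<delta>]
  proof (rule cSup_least)
    show "polygonal_sums ?\<delta> s t \<noteq> {}"
      using dist_in_polygonal_sums[OF that(2), of ?\<delta>] by blast
    fix x assume "x \<in> polygonal_sums ?\<delta> s t"
    then obtain y where "y \<in> polygonal_sums \<gamma> s t" "x \<le> c * y"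
    proof (rule polygonal_sums_lipschitz[of s t ?\<delta> c \<gamma> x, rotated])
      show "dist (?\<delta> u) (?\<delta> v) \<le> c * dist (\<gamma> u) (\<gamma> v)" if "u \<in> {s..t}" "v \<in> {s..t}" for u v
        using that \<open>0 \<le> s\<close> \<open>t \<le> 1\<close> by (intro lip\<delta>) auto
    qed (rule that)
    then show "x \<le> c * arc_length \<gamma> s t"
      using g.polygonal_sum_le_arc_length[OF that] \<open>0 < c\<close>
      by (meson less_imp_le mult_left_mono order_trans)
  qed
  let ?L = "arc_length \<gamma> 0 1" and ?M = "arc_length ?\<delta> 0 1"
  define \<phi> where "\<phi> = (\<lambda>s. arc_length ?\<delta> 0 (g.param_time s))"
  have diff: "arc_length ?\<delta> 0 p \<le> arc_length ?\<delta> 0 q \<and>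
      arc_length ?\<delta> 0 q - arc_length ?\<delta> 0 p \<le> c * (arc_length \<gamma> 0 q - arc_length \<gamma> 0 p)"
    if pq: "p \<in> {0..1}" "q \<in> {0..1}" "arc_length \<gamma> 0 p \<le> arc_length \<gamma> 0 q" for p q
  proof (cases "p \<le> q")
    case True
    then show ?thesis
      using pq arc[of p q] g.arc_length_add[of 0 p q] d.arc_length_add[of 0 p q] d.arc_length_nonneg[of p q] by auto
  next
    case False
    \<comment> \<open>Here \<open>q < p\<close> although \<open>\<gamma>\<close> is at least as long
      up to \<open>q\<close> as up to \<open>p\<close>. So it has no length on [q, p], and neither
      has its image.\<close>
    have "arc_length \<gamma> q p = 0" "arc_length \<gamma> 0 q = arc_length \<gamma> 0 p"
      using False pq g.arc_length_add[of 0 q p] g.arc_length_nonneg[of q p] by auto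
    moreover from this have "arc_length ?\<delta> q p = 0"
      using False pq arc[of q p] d.arc_length_nonneg[of q p] by auto
    ultimately show ?thesis
      using False pq d.arc_length_add[of 0 q p] by auto
  qed
  have \<phi>_mono: "\<phi> s \<le> \<phi> t \<and> \<phi> t - \<phi> s \<le> c * (t - s)" if "0 \<le> s" "s \<le> t" "t \<le> ?L" for s t
    using diff[of "g.param_time s" "g.param_time t"] g.param_time[of s] g.param_time[of t] that
    by (simp add: \<phi>_def)
  \<comment> \<open>Using \<open>diff\<close> in both directions shows that the value is the same
    for every time of the given arc length.\<close>
  have \<phi>_arc: "\<phi> (arc_length \<gamma> 0 t) = arc_length ?\<delta> 0 t" if "t \<in> {0..1}" for t
    using diff[of "g.param_time (arc_length \<gamma> 0 t)" t] diff[of t "g.param_time (arc_length \<gamma> 0 t)"]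
      g.param_time[OF g.arc_length_le_total[OF that]] that
    by (simp add: \<phi>_def)
  have "line_integral \<sigma> ?\<delta> \<le> c * integral {0..?L} (\<lambda>s. \<sigma> (arc_length_param ?\<delta> (\<phi> s)))"
    unfolding line_integral_def
  proof (rule integral_reparam_le)
    show "continuous_on {0..?M} (\<lambda>s. \<sigma> (arc_length_param ?\<delta> s))"
      by (rule d.continuous_on_line_integrand[OF \<sigma>])
    show "0 \<le> ?L" by (simp add: g.arc_length_nonneg)
    show "\<phi> 0 = 0" "\<phi> ?L = ?M"
      using \<phi>_arc[of 0] \<phi>_arc[of 1] by simp_all
    show "0 \<le> \<sigma> (arc_length_param ?\<delta> u)" if "u \<in> {0..?M}" for u
      using d.arc_length_param_in_path_image[OF that] nonneg by (auto simp: path_image_compose)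
  qed (use \<phi>_mono \<open>0 < c\<close> in auto)
  also have "integral {0..?L} (\<lambda>s. \<sigma> (arc_length_param ?\<delta> (\<phi> s))) = integral {0..?L} (\<lambda>s. \<sigma> (f (arc_length_param \<gamma> s)))"
  proof (rule integral_cong)
    fix s assume "s \<in> {0..?L}"
    then show "\<sigma> (arc_length_param ?\<delta> (\<phi> s)) = \<sigma> (f (arc_length_param \<gamma> s))"
      using d.arc_length_param_arc_length[OF g.param_time(1)] by (simp add: \<phi>_def g.arc_length_param_eq)
  qed
  also have "c * \<dots> \<le> c * integral {0..?L} (\<lambda>s. b * \<rho> (arc_length_param \<gamma> s))"
  proof (intro mult_left_mono integral_le integrable_continuous_interval)
    have "continuous_on (path_image \<gamma>) f"
      unfolding continuous_on_iff
    proof (intro ballI allI impI)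
      fix x :: 'a and \<epsilon> :: real assume x: "x \<in> path_image \<gamma>" and "0 < \<epsilon>"
      have "dist (f y) (f x) < \<epsilon>" if "y \<in> path_image \<gamma>" "dist y x < \<epsilon> / c" for y
      proof -
        have "c * dist y x < \<epsilon>"
          using that \<open>0 < c\<close> by (simp add: field_simps)
        then show ?thesis using lip[OF that(1) x] by linarith
      qed
      moreover have "0 < \<epsilon> / c" using \<open>0 < \<epsilon>\<close> \<open>0 < c\<close> by simp
      ultimately show "\<exists>d>0. \<forall>x'\<in>path_image \<gamma>. dist x' x < d \<longrightarrow> dist (f x') (f x) < \<epsilon>"
        by blast
    qed
    then have "continuous_on (path_image \<gamma>) (\<lambda>z. \<sigma> (f z))"
      by (rule continuous_on_compose2[OF \<sigma>]) (simp add: path_image_compose)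
    then show "continuous_on {0..?L} (\<lambda>s. \<sigma> (f (arc_length_param \<gamma> s)))"
      by (rule g.continuous_on_line_integrand)
    show "continuous_on {0..?L} (\<lambda>s. b * \<rho> (arc_length_param \<gamma> s))"
      by (intro continuous_intros g.continuous_on_line_integrand \<rho>)
  qed (use le g.arc_length_param_in_path_image \<open>0 < c\<close> in auto)
  finally show ?thesis
    by (simp only: line_integral_def mult.assoc integral_mult_right)
qed

section \<open>Quasihyperbolic distances under Lipschitz maps\<close>

text \<open>Supplies a competitor, so that the infimum defining the quasihyperbolic distance is over
  a nonempty set. A polynomial path has bounded derivative on [0, 1] and is therefore
  Lipschitz.\<close>

lemma ex_rectifiable_path:
  fixes D :: "'a::euclidean_space set"
  assumes "open D" "connected D" "x \<in> D" "y \<in> D"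
  obtains \<gamma> where "rectifiable_path \<gamma>" "path_image \<gamma> \<subseteq> D" "pathstart \<gamma> = x" "pathfinish \<gamma> = y"
proof -
  obtain g where g: "polynomial_function g" "path_image g \<subseteq> D" "pathstart g = x" "pathfinish g = y"
    using connected_open_polynomial_connected[OF assms] by blast
  obtain g' where g': "polynomial_function g'" "\<And>t. (g has_vector_derivative g' t) (at t)"
    using has_vector_derivative_polynomial_function[OF g(1)] by metis
  have "compact (g' ` {0..1})"
    using continuous_on_polymonial_function[OF g'(1)] by (intro compact_continuous_image) auto
  then obtain C where "0 < C" and C: "\<And>t. t \<in> {0..1} \<Longrightarrow> norm (g' t) \<le> C"
    using compact_imp_bounded bounded_pos by (metis imageI)
  have "rectifiable_path (\<lambda>t::real. t)"
  proof -
    have "x \<le> 1" if "x \<in> polygonal_sums (\<lambda>t::real. t) 0 1" for x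
    proof -
      obtain m t where t: "x = (\<Sum>i<m. dist (t i) (t (Suc i)))" "\<And>i. i < m \<Longrightarrow> t i \<le> t (Suc i)" "t 0 = 0" "t m = (1::real)"
        using \<open>x \<in> _\<close> by (auto simp: polygonal_sums_def)
      then have "x = (\<Sum>i<m. t (Suc i) - t i)"
        by (auto simp: dist_real_def intro!: sum.cong)
      then show ?thesis
        using t by (simp add: sum_lessThan_telescope)
    qed
    then show ?thesis
      by (auto simp: rectifiable_path_def path_def bdd_above_def)
  qed
  then have "rectifiable_path g"
  proof (rule lipschitz_image_rectifiable)
    show "path g"
      using continuous_on_polymonial_function[OF g(1)] by (simp add: path_def)
    show "dist (g s) (g t) \<le> C * dist s t" if "s \<in> {0..1}" "t \<in> {0..1}" for s t
    proof -
      have "norm (g s - g t) \<le> C * norm (s - t)"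
      proof (rule differentiable_bound[where S="{0..1}" and f'="\<lambda>t d. d *\<^sub>R g' t"])
        show "(g has_derivative (\<lambda>d. d *\<^sub>R g' t)) (at t within {0..1})" for t
          using g'(2)[of t] by (simp add: has_vector_derivative_def has_derivative_at_withinI)
        show "onorm (\<lambda>d. d *\<^sub>R g' t) \<le> C" if "t \<in> {0..1}" for t
          using C[OF that] \<open>0 < C\<close> by (intro onorm_le) (simp add: mult.commute[of C] mult_left_mono)
      qed (use that in auto)
      then show ?thesis by (simp add: dist_norm)
    qed
  qed (use \<open>0 < C\<close> in simp)
  with g show ?thesis using that by blast
qed

text \<open>One factor \<open>c\<close> comes from arc length, the other from the density. The
  hypotheses are one-sided, so that the inverse map can be treated in the same way.\<close>

lemma quasihyperbolic_dist_image_le: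
  fixes f :: "'a::euclidean_space \<Rightarrow> 'b::euclidean_space"
  assumes "open D" "connected D" and fD: "f ` D \<subseteq> D'" and "1 \<le> c"
    and lip: "\<And>x y. x \<in> D \<Longrightarrow> y \<in> D \<Longrightarrow> dist (f x) (f y) \<le> c * dist x y"
    and pos: "\<And>z. z \<in> D \<Longrightarrow> 0 < infdist z (frontier D)"
    and pos': "\<And>z. z \<in> D' \<Longrightarrow> 0 < infdist z (frontier D')"
    and infdist_le: "\<And>z. z \<in> D \<Longrightarrow> infdist z (frontier D) \<le> c * infdist (f z) (frontier D')"
    and "x \<in> D" "y \<in> D"
  shows "quasihyperbolic_dist D' (f x) (f y) \<le> c\<^sup>2 * quasihyperbolic_dist D x y"
proof -
  let ?\<rho> = "\<lambda>z. 1 / infdist z (frontier D)" and ?\<sigma> = "\<lambda>z. 1 / infdist z (frontier D')"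
  let ?Q = "\<lambda>\<gamma>. rectifiable_path \<gamma> \<and> path_image \<gamma> \<subseteq> D \<and> pathstart \<gamma> = x \<and> pathfinish \<gamma> = y"
  let ?Q' = "\<lambda>\<gamma>. rectifiable_path \<gamma> \<and> path_image \<gamma> \<subseteq> D' \<and> pathstart \<gamma> = f x \<and> pathfinish \<gamma> = f y"
  have cont_\<rho>: "continuous_on S ?\<rho>" if "S \<subseteq> D" for S
    using pos that by (intro continuous_intros) force
  have cont_\<sigma>: "continuous_on S ?\<sigma>" if "S \<subseteq> D'" for S
    using pos' that by (intro continuous_intros) force
  have "c-lipschitz_on D f"
    using lip \<open>1 \<le> c\<close> by (intro lipschitz_onI) auto
  then have cont_f: "continuous_on D f"
    by (rule lipschitz_on_continuous_on)
  have "quasihyperbolic_dist D' (f x) (f y) / c\<^sup>2 \<le> quasihyperbolic_dist D x y"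
    unfolding quasihyperbolic_dist_def[of D]
  proof (rule cInf_greatest)
    obtain \<gamma> where "?Q \<gamma>"
      using ex_rectifiable_path[OF \<open>open D\<close> \<open>connected D\<close> \<open>x \<in> D\<close> \<open>y \<in> D\<close>] by metis
    then show "{line_integral ?\<rho> \<gamma> |\<gamma>. ?Q \<gamma>} \<noteq> {}" by blast
    fix l assume "l \<in> {line_integral ?\<rho> \<gamma> |\<gamma>. ?Q \<gamma>}"
    then obtain \<gamma> where l: "l = line_integral ?\<rho> \<gamma>" and \<gamma>: "?Q \<gamma>" by blast
    have path: "path (f \<circ> \<gamma>)"
      using \<gamma> cont_f by (intro path_continuous_image) (auto simp: rectifiable_path_def intro: continuous_on_subset)
    have image: "path_image (f \<circ> \<gamma>) \<subseteq> D'"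
      using \<gamma> fD by (auto simp: path_image_compose)
    have "rectifiable_path (f \<circ> \<gamma>)"
      by (rule lipschitz_image_rectifiable[of \<gamma> _ c])
         (use \<gamma> path \<open>1 \<le> c\<close> in \<open>auto simp: path_image_def intro!: lip\<close>)
    then have "?Q' (f \<circ> \<gamma>)"
      using image \<gamma> by (auto simp: pathstart_compose pathfinish_compose)
    then have "quasihyperbolic_dist D' (f x) (f y) \<le> line_integral ?\<sigma> (f \<circ> \<gamma>)"
      unfolding quasihyperbolic_dist_def
    proof (intro cInf_lower)
      \<comment> \<open>A real infimum is informative only for a set bounded below; here 0 is a
        lower bound.\<close>
      show "bdd_below {line_integral ?\<sigma> \<gamma> |\<gamma>. ?Q' \<gamma>}"
        by (rule bdd_belowI[of _ 0]) (auto intro!: line_integral_nonneg cont_\<sigma> simp: infdist_nonneg)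
    qed blast
    also have "\<dots> \<le> c * c * line_integral ?\<rho> \<gamma>"
    proof (rule line_integral_image_le)
      show "?\<sigma> (f z) \<le> c * ?\<rho> z" if "z \<in> path_image \<gamma>" for z
      proof -
        have z: "z \<in> D" using that \<gamma> by blast
        show ?thesis
          using infdist_le[OF z] pos[OF z] pos'[of "f z"] fD z by (auto simp: field_simps)
      qed
    qed (use \<gamma> path \<open>1 \<le> c\<close> cont_\<rho> cont_\<sigma>[OF image] in \<open>auto simp: infdist_nonneg subset_iff intro!: lip\<close>)
    finally show "quasihyperbolic_dist D' (f x) (f y) / c\<^sup>2 \<le> l"
      using \<open>1 \<le> c\<close> by (simp add: l power2_eq_square field_simps)
  qed
  then show ?thesis
    using \<open>1 \<le> c\<close> by (simp add: field_simps)
qed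


section \<open>The quasiconformal case\<close>

text \<open>Compactness makes the image of the closure closed, so \<open>f\<close> commutes with
  closure; injectivity lets it commute with removing \<open>G\<close>.\<close>

lemma frontier_injective_image:
  fixes f :: "'a::metric_space \<Rightarrow> 'b::metric_space"
  assumes "compact (closure G)" "continuous_on (closure G) f" "inj_on f (closure G)" "open G" "open (f ` G)"
  shows "frontier (f ` G) = f ` frontier G"
proof -
  have "closure (f ` G) = f ` closure G"
  proof
    have "closed (f ` closure G)"
      using assms by (intro compact_imp_closed compact_continuous_image)
    then show "closure (f ` G) \<subseteq> f ` closure G"
      by (intro closure_minimal image_mono closure_subset)
    show "f ` closure G \<subseteq> closure (f ` G)"
      by (rule image_closure_subset[OF assms(2)]) (auto intro: closure_subset[THEN subsetD])
  qed
  then show ?thesis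
    using assms inj_on_image_set_diff[OF assms(3), of "closure G" G] closure_subset[of G]
    by (simp add: frontier_def interior_open)
qed

theorem theorem2p31:
  fixes f :: "real^'n \<Rightarrow> real^'n" and \<Omega> G G' :: "(real^'n) set" and K :: real
  assumes "CARD('n) \<ge> 3"
    and "is_domain \<Omega>"
    and "C11_on \<Omega> f"
    and "quasiconformal_on K \<Omega> f"
    and "K < 2 ^ (CARD('n) - 1)"
    and "is_domain G" and "G \<subset> UNIV"
    and "compact (closure G)" and "closure G \<subseteq> \<Omega>"
    and "G' = f ` G"
  shows "bi_lipschitz G dist G' dist f \<and>
         bi_lipschitz G (quasihyperbolic_dist G) G' (quasihyperbolic_dist G') f"
proof -
  have "open \<Omega>" and G: "open G" "connected G" "G \<noteq> {}"
    using assms by (auto simp: is_domain_def)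
  obtain f' :: "real^'n \<Rightarrow> ((real^'n) \<Rightarrow>\<^sub>L (real^'n))"
    where der: "\<And>x. x \<in> \<Omega> \<Longrightarrow> (f has_derivative blinfun_apply (f' x)) (at x)"
      and cont: "continuous_on \<Omega> f'"
      and lip: "\<And>x. x \<in> \<Omega> \<Longrightarrow> \<exists>r>0. \<exists>L. L-lipschitz_on (ball x r \<inter> \<Omega>) f'"
    using \<open>C11_on \<Omega> f\<close> unfolding C11_on_def by blast
  have inj: "inj_on f \<Omega>" and cont_f: "continuous_on \<Omega> f"
    using \<open>quasiconformal_on K \<Omega> f\<close>
    by (auto simp: quasiconformal_on_def homeomorphism_def intro: inj_on_inverseI)
  have inj': "inj (blinfun_apply (f' x))" if "x \<in> \<Omega>" for x
    using quasiconformal_det_nonzero[OF \<open>open \<Omega>\<close> assms(4,5) der cont lip that]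
    by (simp add: det_nz_iff_inj bounded_linear.linear[OF blinfun.bounded_linear_right])
  \<comment> \<open>The estimate is taken on the closure because boundary distances compare points
    of \<open>G\<close> with points of its frontier.\<close>
  obtain c where "1 \<le> c"
    and c: "\<And>x y. x \<in> closure G \<Longrightarrow> y \<in> closure G \<Longrightarrow> dist (f x) (f y) \<le> c * dist x y \<and> dist x y \<le> c * dist (f x) (f y)"
    using compact_bi_lipschitz[OF \<open>open \<Omega>\<close> der cont inj' inj \<open>compact (closure G)\<close> \<open>closure G \<subseteq> \<Omega>\<close>]
    by metis
  have sub: "G \<subseteq> closure G" "frontier G \<subseteq> closure G"
    by (auto simp: closure_subset[THEN subsetD] frontier_def)
  have inj_cl: "inj_on f (closure G)" and cont_cl: "continuous_on (closure G) f"
    using inj cont_f \<open>closure G \<subseteq> \<Omega>\<close> by (auto intro: inj_on_subset continuous_on_subset)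
  have inj_G: "inj_on f G" and cont_G: "continuous_on G f"
    using inj_cl cont_cl sub by (auto intro: inj_on_subset continuous_on_subset)
  have G': "open G'" "connected G'"
    unfolding \<open>G' = f ` G\<close>
    using invariance_of_domain[OF cont_G G(1) inj_G] connected_continuous_image[OF cont_G G(2)] by auto
  have front: "frontier G' = f ` frontier G"
    using frontier_injective_image[OF \<open>compact (closure G)\<close> cont_cl inj_cl G(1)] G' \<open>G' = f ` G\<close> by simp
  \<comment> \<open>A nonempty proper open subset of a connected space has a boundary point. This
    matters because \<open>infdist\<close> to the empty set is 0 by convention.\<close>
  have front_ne: "frontier G \<noteq> {}"
    using \<open>G \<subset> UNIV\<close> G by (auto simp: frontier_eq_empty)
  have pos: "0 < infdist z (frontier D)" if "open D" "frontier D \<noteq> {}" "z \<in> D" for D and z :: "real^'n"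
  proof -
    have "z \<notin> frontier D"
      using that by (simp add: frontier_def interior_open)
    then show ?thesis
      using that by (intro infdist_pos_not_in_closed) auto
  qed
  have pos_G: "0 < infdist z (frontier G)" if "z \<in> G" for z
    by (rule pos[OF G(1) front_ne that])
  have pos_G': "0 < infdist z (frontier G')" if "z \<in> G'" for z
    by (rule pos[OF G'(1) _ that]) (use front front_ne in auto)
  \<comment> \<open>A point of \<open>frontier G'\<close> nearest to \<open>f z\<close> is the image
    of some \<open>w\<close> in \<open>frontier G\<close>, so the estimate for the pair
    \<open>z\<close>, \<open>w\<close> suffices.\<close>
  have infdist_lower: "infdist z (frontier G) \<le> c * infdist (f z) (frontier G')" if "z \<in> G" for z
  proof -
    obtain w where w: "w \<in> frontier G" "infdist (f z) (frontier G') = dist (f z) (f w)"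
      using infdist_attains_inf[OF frontier_closed, of G' "f z"] front_ne front by (metis image_iff image_is_empty)
    have "infdist z (frontier G) \<le> dist z w"
      using w by (intro infdist_le) auto
    also have "\<dots> \<le> c * dist (f z) (f w)"
      using c w sub that by blast
    finally show ?thesis using w by simp
  qed
  have infdist_upper: "infdist (f z) (frontier G') \<le> c * infdist z (frontier G)" if "z \<in> G" for z
  proof -
    obtain w where w: "w \<in> frontier G" "infdist z (frontier G) = dist z w"
      using infdist_attains_inf[OF frontier_closed front_ne, of z] by metis
    have "infdist (f z) (frontier G') \<le> dist (f z) (f w)"
      using w front by (intro infdist_le) auto
    also have "\<dots> \<le> c * dist z w"
      using c w sub that by blast
    finally show ?thesis using w by simp
  qed
  have lip_G: "dist (f x) (f y) \<le> c * dist x y" "dist x y \<le> c * dist (f x) (f y)" if "x \<in> G" "y \<in> G" for x y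
    using c that sub by blast+
  \<comment> \<open>The lower quasihyperbolic bound is the upper bound for the inverse map from
    \<open>G'\<close> onto \<open>G\<close>.\<close>
  let ?g = "inv_into G f"
  have g: "?g (f x) = x" if "x \<in> G" for x
    using inv_into_f_f[OF inj_G that] .
  have "quasihyperbolic_dist G' (f x) (f y) \<le> c\<^sup>2 * quasihyperbolic_dist G x y" if "x \<in> G" "y \<in> G" for x y
    by (rule quasihyperbolic_dist_image_le)
       (use G G' \<open>1 \<le> c\<close> lip_G infdist_lower pos_G pos_G' that \<open>G' = f ` G\<close> in auto)
  moreover have "quasihyperbolic_dist G x y \<le> c\<^sup>2 * quasihyperbolic_dist G' (f x) (f y)" if "x \<in> G" "y \<in> G" for x y
  proof -
    have "quasihyperbolic_dist G (?g (f x)) (?g (f y)) \<le> c\<^sup>2 * quasihyperbolic_dist G' (f x) (f y)"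
      by (rule quasihyperbolic_dist_image_le)
         (use G G' \<open>1 \<le> c\<close> lip_G infdist_upper pos_G pos_G' that g \<open>G' = f ` G\<close> in auto)
    then show ?thesis using g that by simp
  qed
  ultimately have "bi_lipschitz G (quasihyperbolic_dist G) G' (quasihyperbolic_dist G') f"
    unfolding bi_lipschitz_def using \<open>1 \<le> c\<close> \<open>G' = f ` G\<close>
    by (intro conjI exI[of _ "c\<^sup>2"]) (auto simp: field_simps)
  moreover have "bi_lipschitz G dist G' dist f"
    unfolding bi_lipschitz_def using \<open>1 \<le> c\<close> \<open>G' = f ` G\<close> lip_G
    by (intro conjI exI[of _ c]) (auto simp: field_simps)
  ultimately show ?thesis by simp
qed

end
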